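(* Let $d\ge2$. Let $(\mathcal H,\Theta)$ be the height and angle at a fixed point $x_0\in\mathbb R^{d-1}$ of the boundary hypersurface $\partial\mathcal T_d$ of the typical ideal cell $\mathcal T_d$. Then: (i) conditionally on $R_1=s$, $$\Big(\frac1{\mathcal H^{d-1}},\ \sin^2(\Theta)\Big)\sim\mathrm{Exp}(s)\otimes\mathrm{Beta}\Big(\frac{d+1}2,\frac{d-1}2\Big);$$ (ii) averaging over the value of $R_1$, $$\big(\mathcal H^{d-1},\ \sin^2(\Theta)\big)\sim\frac{1-U}U\otimes\mathrm{Beta}\Big(\frac{d+1}2,\frac{d-1}2\Big),$$ where $U$ is uniform on $[0,1]$ (and $\otimes$ means the two coordinates are independent with the indicated laws).
   Context: $c_d=2^{2-d}\pi^{d/2}/\Gamma(d/2)$; $\mathrm{Exp}(s)$ is the exponential law with rate $s$. Typical cell: let $R_1$ be an $\mathrm{Exp}(1)$ random variable. Conditionally on $R_1=s$, let $\Pi$ be a Poisson point process of pairs $(x,\rho)\in\mathbb R^{d-1}\times\mathbb R_+$ with intensity $2\frac{d-1}{c_d}\,s\,\mathrm dx\,\rho^{1-2d}\,\mathrm d\rho$, and let $\mathcal T_d=\mathcal T_d(s)$ be the closed subset of the upper half-space $\mathbb R^{d-1}\times(0,\infty)$ obtained by removing all open Euclidean balls with center $(x,0)$ and radius $\rho$, $(x,\rho)\in\Pi$. The set $\mathcal T_d$ is the epigraph of a stationary random function $\widetilde{\mathcal H}:\mathbb R^{d-1}\to\mathbb R_+$. For $x_0\in\mathbb R^{d-1}$,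 $\widetilde{\mathcal H}(x_0)$ is the height of $\partial\mathcal T_d$ above $x_0$, and $\Psi(x_0)\in[0,\pi/2]$ is the angle that the hypersurface $\partial\mathcal T_d$ makes with the vertical direction at that point (i.e. $\pi/2$ minus the angle between the vertical direction and the direction orthogonal to the hypersurface), which is a.s. defined at a given $x_0$. By stationarity the law of $(\widetilde{\mathcal H}(x_0),\Psi(x_0))$ does not depend on $x_0$; the pair is denoted $(\mathcal H,\Theta)$. *)

theory Defs
  imports "HOL-Probability.Probability"
begin

section \<open>Laws and conditional laws\<close>

text \<open>
  The variables studied here are only defined almost surely, so measurability is required with
  respect to the completion: \<open>X\<close> has law \<open>L\<close> iff it agrees almost everywhere with a measurable
  variable whose distribution is \<open>L\<close>.
\<close>

definition has_law :: "'w measure \<Rightarrow> ('w \<Rightarrow> 'b) \<Rightarrow> 'b measure \<Rightarrow> bool" where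
  "has_law M X L \<longleftrightarrow> X \<in> completion M \<rightarrow>\<^sub>M L \<and> distr (completion M) L X = L"

text \<open>
  The kernel \<open>K\<close> is a regular conditional law of \<open>X\<close> given \<open>R\<close>: conditionally on \<open>R = s\<close>,
  the variable \<open>X\<close> has law \<open>K s\<close>.
\<close>

definition conditional_law ::
  "'w measure \<Rightarrow> ('w \<Rightarrow> 'r) \<Rightarrow> 'r measure \<Rightarrow> ('w \<Rightarrow> 'b) \<Rightarrow> 'b measure \<Rightarrow> ('r \<Rightarrow> 'b measure) \<Rightarrow> bool"
where
  "conditional_law M R S X N K \<longleftrightarrow>
     R \<in> M \<rightarrow>\<^sub>M S \<and> X \<in> M \<rightarrow>\<^sub>M N \<and> K \<in> S \<rightarrow>\<^sub>M prob_algebra N \<and>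
     (\<forall>B\<in>sets S. \<forall>C\<in>sets N.
        emeasure M {\<omega>\<in>space M. R \<omega> \<in> B \<and> X \<omega> \<in> C} =
        (\<integral>\<^sup>+\<omega>. indicator B (R \<omega>) * emeasure (K (R \<omega>)) C \<partial>M))"

definition exponential_law :: "real \<Rightarrow> real measure" where
  "exponential_law s = density lborel (\<lambda>x. ennreal (exponential_density s x))"

definition beta_law :: "real \<Rightarrow> real \<Rightarrow> real measure" where
  "beta_law a b = density lborel (\<lambda>x.
     ennreal (indicator {0<..<1} x * x powr (a - 1) * (1 - x) powr (b - 1) / Beta a b))"

definition uniform_law :: "real measure" where
  "uniform_law = uniform_measure lborel {0..1}"

section \<open>Poisson point processes\<close>

text \<open>
  Configurations are locally finite subsets of \<open>S\<close>; sets rather than multisets suffice because the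
  intensity measure used below is diffuse. The sigma-algebra is generated by the counting maps.
\<close>

definition locally_finite_sets :: "'b::topological_space set \<Rightarrow> 'b set set" where
  "locally_finite_sets S = {\<phi>. \<phi> \<subseteq> S \<and> (\<forall>C. compact C \<and> C \<subseteq> S \<longrightarrow> finite (\<phi> \<inter> C))}"

definition num_points :: "'b set \<Rightarrow> 'b set \<Rightarrow> ennreal" where
  "num_points A \<phi> = emeasure (count_space UNIV) (\<phi> \<inter> A)"

definition config_space :: "'b::topological_space set \<Rightarrow> 'b set measure" where
  "config_space S = sigma (locally_finite_sets S)
     {num_points A -` B \<inter> locally_finite_sets S | A B. A \<in> sets borel \<and> B \<in> sets borel}"

definition poisson_process_law ::
  "'b::topological_space set \<Rightarrow> 'b measure \<Rightarrow> 'b set measure \<Rightarrow> bool"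
where
  "poisson_process_law S \<mu> P \<longleftrightarrow>
     prob_space P \<and> space P = locally_finite_sets S \<and> sets P = sets (config_space S) \<and>
     (\<forall>A\<in>sets borel. emeasure \<mu> A < \<infinity> \<longrightarrow>
        (\<forall>k. measure P {\<phi>\<in>space P. num_points A \<phi> = of_nat k} =
             measure \<mu> A ^ k / fact k * exp (- measure \<mu> A))) \<and>
     (\<forall>(m::nat) A. (\<forall>i<m. A i \<in> sets borel) \<and> disjoint_family_on A {..<m} \<longrightarrow>
        prob_space.indep_vars P (\<lambda>_. borel) (\<lambda>i. num_points (A i)) {..<m})"

section \<open>The typical cell\<close>

definition c_const :: "nat \<Rightarrow> real" where
  "c_const d = 2 powr (2 - real d) * pi powr (real d / 2) / Gamma (real d / 2)"

text \<open>
  The horizontal space of dimension \<open>d - 1\<close> is the Euclidean space \<open>'a\<close>; the last coordinate of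
  \<open>'a \<times> real\<close> is the radius for points of the process, and the height for points of the cell.
\<close>

definition upper_half_space :: "('a::euclidean_space \<times> real) set" where
  "upper_half_space = UNIV \<times> {0<..}"

definition cell_intensity :: "nat \<Rightarrow> real \<Rightarrow> ('a::euclidean_space \<times> real) measure" where
  "cell_intensity d s = density lborel (\<lambda>(x, \<rho>).
     ennreal (indicator {0<..} \<rho> * (2 * ((real d - 1) / c_const d) * s * \<rho> powr (1 - 2 * real d))))"

definition cell :: "('a::euclidean_space \<times> real) set \<Rightarrow> ('a \<times> real) set" where
  "cell \<phi> = upper_half_space - (\<Union>(x, \<rho>)\<in>\<phi>. ball (x, 0) \<rho>)"

text \<open>The function whose epigraph is the cell.\<close>

definition cell_height :: "('a::euclidean_space \<times> real) set \<Rightarrow> 'a \<Rightarrow> real" where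
  "cell_height \<phi> x = Inf {h. (x, h) \<in> cell \<phi>}"

text \<open>
  A nonzero vector \<open>n\<close> is orthogonal to the hypersurface \<open>S\<close> at \<open>p\<close> if \<open>n \<bullet> (q - p)\<close> is negligible
  compared to \<open>norm (q - p)\<close> as \<open>q\<close> tends to \<open>p\<close> in \<open>S\<close>.
\<close>

definition orthogonal_to_hypersurface :: "'b::euclidean_space set \<Rightarrow> 'b \<Rightarrow> 'b \<Rightarrow> bool" where
  "orthogonal_to_hypersurface S p n \<longleftrightarrow>
     n \<noteq> 0 \<and> ((\<lambda>q. n \<bullet> (q - p) / norm (q - p)) \<longlongrightarrow> 0) (at p within S)"

text \<open>
  The angle between the line spanned by \<open>n\<close> and the vertical one is an unoriented angle in
  \<open>[0, pi/2]\<close>, whence the absolute value. Where the hypersurface has a ridge there is no orthogonal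
  direction and the value of \<open>cell_angle\<close> is unspecified.
\<close>

definition cell_angle :: "('a::euclidean_space \<times> real) set \<Rightarrow> 'a \<Rightarrow> real" where
  "cell_angle \<phi> x = (THE \<psi>. \<exists>n.
     orthogonal_to_hypersurface (frontier (cell \<phi>)) (x, cell_height \<phi> x) n \<and>
     \<psi> = pi / 2 - arccos (\<bar>n \<bullet> (0, 1)\<bar> / norm n))"

end

theory Submission
  imports Defs "HOL-Real_Asymp.Real_Asymp"
begin

text \<open>
  Write \<open>n = d - 1\<close> for the dimension of the horizontal space. The removed ball with centre
  \<open>(x, 0)\<close> and radius \<open>\<rho>\<close> covers the vertical line above \<open>x\<^sub>0\<close> up to the height
  \<open>h = sqrt (\<rho>\<^sup>2 - |x - x\<^sub>0|\<^sup>2)\<close>, provided that \<open>|x - x\<^sub>0| < \<rho>\<close>. Hence \<open>\<H>\<close> is the largest of these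
  heights, and near the point \<open>(x\<^sub>0, \<H>)\<close> the boundary of the cell is the sphere that attains it. The
  normal there is the radius of that sphere, so the squared sine of the angle is
  \<open>h\<^sup>2 / \<rho>\<^sup>2 = 1 - |x - x\<^sub>0|\<^sup>2 / \<rho>\<^sup>2\<close> (lemma \<open>height_and_angle_of_highest_cap\<close>).

  Attach to a point of the process its level \<open>1 / h ^ n\<close> and its slope \<open>1 - |x - x\<^sub>0|\<^sup>2 / \<rho>\<^sup>2\<close>. In
  these coordinates the intensity becomes \<open>s\<close> times Lebesgue measure on the levels, times the beta
  law on the slopes (lemma \<open>emeasure_strip\<close>): for fixed \<open>\<rho>\<close> the slope of a uniform point of the disc
  has density proportional to \<open>(1 - t) powr (n/2 - 1)\<close>, and integrating over the radii whose level is
  at most \<open>b\<close> brings in the factor \<open>b * t powr (n/2)\<close>. The constant \<open>c_const\<close> is exactly the one for which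
  the total mass is right, by the duplication formula of the Gamma function.

  So \<open>1 / \<H> ^ n\<close> is the first point of a homogeneous Poisson process of rate \<open>s\<close> on the half-line and
  the squared sine is the independent mark of that point. To get the law of the pair from the
  independence of the counts over disjoint sets, the half-line above \<open>a\<close> is cut into intervals of
  length \<open>\<delta>\<close>. The probability that all intervals before the \<open>i\<close>-th one are empty and that the \<open>i\<close>-th one has
  exactly one point, with mark in \<open>C\<close>, is explicit; the sum over \<open>i\<close> tends to \<open>exp (- s * a) * \<beta> C\<close> as \<open>\<delta>\<close> tends to \<open>0\<close>
  (lemma \<open>prob_leader_ge\<close>). This is a lower bound for the probability that the level exceeds \<open>a\<close> and the
  mark lies in \<open>C\<close>. The same bound for the complement of \<open>C\<close>, together with the probability of a level at
  most \<open>a\<close>, adds up to \<open>1\<close>, so all the bounds are equalities. In particular the highest ball is almost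
  surely unique, and events that involve the height and the angle, which are not given as measurable
  functions of the configuration, are squeezed between measurable ones
  (lemma \<open>has_law_of_inner_events\<close>).

  The squeezing events do not depend on \<open>s\<close>. Their probabilities under \<open>M\<close> are therefore obtained by
  integrating over the exponential law of \<open>R\<^sub>1\<close>, and the
  value \<open>1 / (1 + a)\<close> of the integral of \<open>exp (- r * a) * exp (- r)\<close> over \<open>r \<ge> 0\<close> is the probability that \<open>(1 - U) / U < 1 / a\<close>.
\<close>

section \<open>Identifying a law from inner approximations of events\<close>

text \<open>
  The events \<open>A\<close> and \<open>B\<close> are disjoint, so their probabilities add up to at most \<open>1 = p + (1 - p)\<close> and both
  lower bounds are attained. Thus \<open>A\<close> and \<open>B\<close> fill the space up to a null set, and \<open>S\<close> differs from \<open>A\<close> by a subset of it.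
\<close>

lemma (in prob_space) completion_measurable_of_inner_events:
  assumes A: "A \<in> events" "A \<subseteq> S" and B: "B \<in> events" "B \<subseteq> space M - S" and S: "S \<subseteq> space M"
    and ge: "p \<le> prob A" "1 - p \<le> prob B"
  shows "S \<in> sets (completion M)" "emeasure (completion M) S = ennreal p"
proof -
  have "prob (A \<union> B) = prob A + prob B"
    using A B by (intro finite_measure_Union) auto
  moreover have "prob (A \<union> B) \<le> 1" by simp
  ultimately have p: "prob A = p" "prob B = 1 - p" "prob (A \<union> B) = 1" using ge by linarith+
  define N where "N = space M - (A \<union> B)"
  have N: "N \<in> null_sets M"
    using A B p(3) prob_compl[of "A \<union> B"] by (intro null_setsI) (auto simp: N_def emeasure_eq_measure)
  have SA: "S = A \<union> (S - A)" "S - A \<subseteq> N" using A B S by (auto simp: N_def)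
  show S': "S \<in> sets (completion M)"
    by (rule sets_completionI[OF SA N A(1)])
  have "S - A \<in> null_sets (completion M)"
    using SA(2) N by (auto simp: null_sets_completion_iff2)
  then have "emeasure (completion M) (A \<union> (S - A)) = emeasure (completion M) A"
    using A(1) by (intro emeasure_Un_null_set) auto
  also have "\<dots> = ennreal p" using A(1) p by (simp add: emeasure_completion emeasure_eq_measure main_part_sets)
  finally show "emeasure (completion M) S = ennreal p" using SA(1) by simp
qed

text \<open>
  Measurability of \<open>X\<close> with respect to the completion is a consequence of the bounds: they force the two
  approximating events to have complementary probabilities.
\<close>

lemma has_law_of_inner_events:
  assumes M: "prob_space M" and L: "prob_space L" "space L = UNIV"
    and E: "Int_stable E" "sets L = sigma_sets UNIV E"
    and inner: "\<And>G. G \<in> E \<Longrightarrow> \<exists>A\<in>sets M. \<exists>B\<in>sets M. A \<subseteq> X -` G \<and> B \<inter> X -` G = {} \<and>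
      measure L G \<le> measure M A \<and> 1 - measure L G \<le> measure M B"
  shows "has_law M X L"
proof -
  interpret M: prob_space M by fact
  interpret L: prob_space L by fact
  have G: "X -` G \<inter> space M \<in> sets (completion M) \<and> emeasure (completion M) (X -` G \<inter> space M) = emeasure L G" if "G \<in> E" for G
  proof -
    from inner[OF that] obtain A B where "A \<in> sets M" "B \<in> sets M" "A \<subseteq> X -` G" "B \<inter> X -` G = {}"
      "measure L G \<le> measure M A" "1 - measure L G \<le> measure M B" by blast
    moreover from this have "A \<subseteq> X -` G \<inter> space M" "B \<subseteq> space M - X -` G \<inter> space M"
      by (auto dest: sets.sets_into_space)
    ultimately show ?thesis
      using M.completion_measurable_of_inner_events[of A "X -` G \<inter> space M" B "measure L G"]
      unfolding L.emeasure_eq_measure by (meson inf_le2)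
  qed
  have "X \<in> completion M \<rightarrow>\<^sub>M sigma UNIV E"
    using G by (intro measurable_measure_of) auto
  moreover have "sets (sigma UNIV E) = sets L" using E(2) by (simp add: sets_measure_of)
  ultimately have X: "X \<in> completion M \<rightarrow>\<^sub>M L" by (simp cong: measurable_cong_sets)
  interpret C: prob_space "completion M"
    by (rule prob_spaceI) (simp add: M.emeasure_space_1)
  interpret D: prob_space "distr (completion M) L X" using X by (rule C.prob_space_distr)
  have "distr (completion M) L X = L"
  \<comment> \<open>The whole space is added to the generator because the uniqueness theorem asks for a cover by generating sets.\<close>
  proof (rule measure_eqI_generator_eq[where E="insert UNIV E" and \<Omega>=UNIV and A="\<lambda>_. UNIV"])
    show "Int_stable (insert UNIV E)" using E(1) by (auto simp: Int_stable_def)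
    have "sigma_sets UNIV (insert UNIV E) = sigma_sets UNIV E"
      by (rule sigma_sets_eqI) (auto intro: sigma_sets_top)
    then show "sets (distr (completion M) L X) = sigma_sets UNIV (insert UNIV E)" "sets L = sigma_sets UNIV (insert UNIV E)"
      using E(2) by auto
    fix G assume "G \<in> insert UNIV E"
    then show "emeasure (distr (completion M) L X) G = emeasure L G"
    proof
      assume "G = UNIV"
      then show ?thesis using D.emeasure_space_1 L.emeasure_space_1 L(2) by simp
    next
      assume "G \<in> E"
      then show ?thesis using G[of G] E(2) by (simp add: emeasure_distr[OF X] sigma_sets.Basic)
    qed
  qed auto
  with X show ?thesis by (simp add: has_law_def)
qed

lemma sigma_sets_rectangles:
  fixes \<G> :: "real set set"
  assumes G: "(borel :: real measure) = sigma UNIV \<G>" and cover: "range F \<subseteq> \<G>" "(\<Union>i::nat. F i) = UNIV"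
  shows "sets (borel \<Otimes>\<^sub>M borel :: (real \<times> real) measure) = sigma_sets UNIV {H \<times> C | H C. H \<in> \<G> \<and> C \<in> sets borel}"
proof -
  have "sigma UNIV \<G> \<Otimes>\<^sub>M sigma UNIV (sets (borel :: real measure)) =
     (sigma (UNIV \<times> UNIV) {H \<times> C | H C. H \<in> \<G> \<and> C \<in> sets (borel :: real measure)})"
  proof (rule sigma_prod)
    show "\<exists>E\<subseteq>\<G>. countable E \<and> UNIV = \<Union>E"
      using cover by (intro exI[of _ "range F"]) auto
    show "\<exists>E\<subseteq>sets (borel :: real measure). countable E \<and> UNIV = \<Union>E"
      by (intro exI[of _ "{UNIV}"]) auto
  qed auto
  moreover have "sets (sigma UNIV \<G> \<Otimes>\<^sub>M sigma UNIV (sets (borel :: real measure))) = sets (borel \<Otimes>\<^sub>M borel)"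
  proof (rule sets_pair_measure_cong)
    show "sets (sigma UNIV \<G>) = sets borel" unfolding G[symmetric] ..
    show "sets (sigma UNIV (sets (borel :: real measure))) = sets borel"
      using sets.sigma_sets_eq[of "borel :: real measure"] by (simp add: sets_measure_of)
  qed
  ultimately have "sets (borel \<Otimes>\<^sub>M borel :: (real \<times> real) measure) =
      sets (sigma (UNIV \<times> UNIV) {H \<times> C | H C. H \<in> \<G> \<and> C \<in> sets (borel :: real measure)})"
    by (simp only:)
  also have "\<dots> = sigma_sets UNIV {H \<times> C | H C. H \<in> \<G> \<and> C \<in> sets borel}"
    by (subst sets_measure_of) auto
  finally show ?thesis .
qed

lemma Int_stable_rectangles:
  fixes \<G> :: "real set set"
  shows "Int_stable \<G> \<Longrightarrow> Int_stable {H \<times> C | H C. H \<in> \<G> \<and> C \<in> sets (borel :: real measure)}"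
  unfolding Int_stable_def by (auto simp: Times_Int_Times) blast

text \<open>
  For a product law of two real coordinates, rectangles suffice as generator; the second side ranges
  over all Borel sets, since complements of it have to be taken later on.
\<close>

lemma has_law_pair_of_inner_events:
  fixes \<G> :: "real set set" and L1 L2 :: "real measure"
  assumes M: "prob_space M" and L1: "prob_space L1" "sets L1 = sets borel" and L2: "prob_space L2" "sets L2 = sets borel"
    and G: "(borel :: real measure) = sigma UNIV \<G>" "Int_stable \<G>" "range F \<subseteq> \<G>" "(\<Union>i::nat. F i) = UNIV"
    and inner: "\<And>H C. H \<in> \<G> \<Longrightarrow> C \<in> sets borel \<Longrightarrow> \<exists>A\<in>sets M. \<exists>B\<in>sets M.
      A \<subseteq> {\<omega>. X \<omega> \<in> H \<and> Y \<omega> \<in> C} \<and> B \<subseteq> {\<omega>. \<not> (X \<omega> \<in> H \<and> Y \<omega> \<in> C)} \<and>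
      measure L1 H * measure L2 C \<le> measure M A \<and> 1 - measure L1 H * measure L2 C \<le> measure M B"
  shows "has_law M (\<lambda>\<omega>. (X \<omega>, Y \<omega>)) (L1 \<Otimes>\<^sub>M L2)"
proof (rule has_law_of_inner_events[OF M])
  interpret L1: prob_space L1 by fact
  interpret L2: prob_space L2 by fact
  interpret P: pair_prob_space L1 L2 ..
  have sp: "space L1 = UNIV" "space L2 = UNIV" using L1 L2 by (auto dest: sets_eq_imp_space_eq)
  show "prob_space (L1 \<Otimes>\<^sub>M L2)" by (rule P.prob_space_axioms)
  show "space (L1 \<Otimes>\<^sub>M L2) = UNIV" by (simp add: space_pair_measure sp)
  show "Int_stable {H \<times> C | H C. H \<in> \<G> \<and> C \<in> sets (borel :: real measure)}" by (rule Int_stable_rectangles[OF G(2)])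
  have "sets (L1 \<Otimes>\<^sub>M L2) = sets (borel \<Otimes>\<^sub>M borel)"
    using L1 L2 by (intro sets_pair_measure_cong) auto
  then show "sets (L1 \<Otimes>\<^sub>M L2) = sigma_sets UNIV {H \<times> C | H C. H \<in> \<G> \<and> C \<in> sets (borel :: real measure)}"
    using sigma_sets_rectangles[OF G(1) G(3,4)] by simp
  fix R assume "R \<in> {H \<times> C | H C. H \<in> \<G> \<and> C \<in> sets (borel :: real measure)}"
  then obtain H C where R: "R = H \<times> C" "H \<in> \<G>" "C \<in> sets borel" by blast
  have "H \<in> sets borel" unfolding G(1) using R(2) by (simp add: sets_measure_of sigma_sets.Basic)
  then have m: "measure (L1 \<Otimes>\<^sub>M L2) R = measure L1 H * measure L2 C"
    using R L1 L2 by (simp add: measure_def L2.emeasure_pair_measure_Times enn2real_mult)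
  from inner[OF R(2,3)] obtain A B where "A \<in> sets M" "B \<in> sets M" "A \<subseteq> {\<omega>. X \<omega> \<in> H \<and> Y \<omega> \<in> C}"
     "B \<subseteq> {\<omega>. \<not> (X \<omega> \<in> H \<and> Y \<omega> \<in> C)}"
     "measure L1 H * measure L2 C \<le> measure M A" "1 - measure L1 H * measure L2 C \<le> measure M B" by blast
  then have "A \<in> sets M" "B \<in> sets M" "A \<subseteq> (\<lambda>\<omega>. (X \<omega>, Y \<omega>)) -` R \<and> B \<inter> (\<lambda>\<omega>. (X \<omega>, Y \<omega>)) -` R = {} \<and>
      measure (L1 \<Otimes>\<^sub>M L2) R \<le> measure M A \<and> 1 - measure (L1 \<Otimes>\<^sub>M L2) R \<le> measure M B"
    unfolding m by (auto simp: R(1))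
  then show "\<exists>A\<in>sets M. \<exists>B\<in>sets M. A \<subseteq> (\<lambda>\<omega>. (X \<omega>, Y \<omega>)) -` R \<and> B \<inter> (\<lambda>\<omega>. (X \<omega>, Y \<omega>)) -` R = {} \<and>
      measure (L1 \<Otimes>\<^sub>M L2) R \<le> measure M A \<and> 1 - measure (L1 \<Otimes>\<^sub>M L2) R \<le> measure M B"
    by blast
qed

section \<open>The exponential, beta and odds laws\<close>

lemma sets_exponential_law [simp, measurable_cong]: "sets (exponential_law s) = sets borel"
  and space_exponential_law [simp]: "space (exponential_law s) = UNIV"
  by (simp_all add: exponential_law_def)

lemma prob_space_exponential_law: "s > 0 \<Longrightarrow> prob_space (exponential_law s)"
  unfolding exponential_law_def by (rule prob_space_exponential_density)

lemma measure_exponential_law_greaterThan: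
  assumes s: "s > 0"
  shows "measure (exponential_law s) {a<..} = exp (- s * max 0 a)"
proof -
  interpret prob_space "exponential_law s" by (rule prob_space_exponential_law[OF s])
  have "emeasure (exponential_law s) {..a} = ennreal (if 0 \<le> a then 1 - exp (- s * a) else 0)"
    unfolding exponential_law_def by (simp add: emeasure_erlang_density[OF s] erlang_CDF_0)
  then have "prob {..a} = (if 0 \<le> a then 1 - exp (- s * a) else 0)"
    using s by (auto simp: measure_def)
  moreover have "prob {a<..} = 1 - prob {..a}"
  proof -
    have "{a<..} = space (exponential_law s) - {..a}" by auto
    then show ?thesis by (simp only: prob_compl sets_exponential_law atMost_borel)
  qed
  ultimately show ?thesis by (simp add: max_def)
qed

lemma prob_space_odds: "prob_space (distr uniform_law borel (\<lambda>u. (1 - u) / u))"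
proof -
  have "prob_space uniform_law" unfolding uniform_law_def
    by (rule prob_space_uniform_measure) auto
  then show ?thesis by (rule prob_space.prob_space_distr) (simp add: uniform_law_def)
qed

text \<open>
  Since \<open>1 / 0 = 0\<close>, the odds \<open>(1 - u) / u\<close> take the value \<open>0\<close> at \<open>u = 0\<close>, hence the additional point \<open>0\<close> of the preimage
  in the proof.
\<close>

lemma measure_odds_lessThan:
  "measure (distr uniform_law borel (\<lambda>u. (1 - u) / u)) {..<y} = (if 0 < y then y / (1 + y) else 0)"
proof -
  let ?E = "{u. (1 - u) / u < y}"
  have E: "?E \<in> sets borel" by measurable
  have "measure (distr uniform_law borel (\<lambda>u. (1 - u) / u)) {..<y} = measure uniform_law ?E"
    by (subst measure_distr) (auto simp: uniform_law_def vimage_def)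
  also have "\<dots> = measure lborel ({0..1} \<inter> ?E)"
    unfolding uniform_law_def using E by (subst measure_uniform_measure) auto
  also have "{0..1} \<inter> ?E = (if 0 < y then insert 0 {1 / (1 + y)<..1} else {})"
  proof -
    have "u \<in> {0..1} \<inter> ?E \<longleftrightarrow> u \<in> (if 0 < y then insert 0 {1 / (1 + y)<..1} else {})" for u
    proof (cases "0 < u \<and> u \<le> 1")
      case True
      then have "(1 - u) / u < y \<longleftrightarrow> 1 < (1 + y) * u" by (simp add: divide_less_eq algebra_simps)
      moreover have "0 \<le> (1 - u) / u" using True by simp
      then have "\<not> (1 - u) / u < y" if "y \<le> 0" using that by linarith
      ultimately show ?thesis using True by (auto simp: divide_less_eq mult.commute)
    next
      case False
      then show ?thesis
        by (auto intro: less_le_trans[of 0 "1 / (1 + y)"] simp: not_less)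
           (smt (verit) divide_pos_pos)+
    qed
    then show ?thesis by blast
  qed
  also have "measure lborel \<dots> = (if 0 < y then y / (1 + y) else 0)"
  proof (cases "0 < y")
    case True
    have "measure lborel (insert 0 {1 / (1 + y)<..1}) = measure lborel ({1 / (1 + y)<..1} \<union> {0})" by simp
    also have "\<dots> = measure lborel {1 / (1 + y)<..1}"
      unfolding measure_def by (subst emeasure_Un_null_set) (auto simp: null_sets_def)
    also have "\<dots> = y / (1 + y)" using True by (simp add: field_simps)
    finally show ?thesis using True by simp
  qed simp
  finally show ?thesis .
qed

text \<open>
  Tilting the standard exponential density by \<open>exp (- r * a)\<close> gives the density of rate \<open>1 + a\<close>, up to
  the factor \<open>1 + a\<close>.
\<close>

lemma nn_integral_exponential_law:
  assumes "0 \<le> a" "0 \<le> p"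
  shows "(\<integral>\<^sup>+r. ennreal (exp (- r * a) * p) \<partial>exponential_law 1) = ennreal (p / (1 + a))"
proof -
  interpret E: prob_space "exponential_law (1 + a)" using assms by (intro prob_space_exponential_law) simp
  have "(\<integral>\<^sup>+r. ennreal (exp (- r * a) * p) \<partial>exponential_law 1) =
    (\<integral>\<^sup>+r. ennreal (exponential_density 1 r) * ennreal (exp (- r * a) * p) \<partial>lborel)"
    unfolding exponential_law_def by (rule nn_integral_density) measurable
  also have "\<dots> = (\<integral>\<^sup>+r. ennreal (p / (1 + a)) * ennreal (exponential_density (1 + a) r) \<partial>lborel)"
  proof (rule nn_integral_cong)
    fix r :: real
    have "1 + a \<noteq> 0" using assms by simp
    then have "exponential_density 1 r * (exp (- r * a) * p) = p / (1 + a) * exponential_density (1 + a) r"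
      by (simp add: exponential_density_def exp_add[symmetric] distrib_left mult_ac)
    then show "ennreal (exponential_density 1 r) * ennreal (exp (- r * a) * p) =
        ennreal (p / (1 + a)) * ennreal (exponential_density (1 + a) r)"
      using assms by (simp only: ennreal_mult'[symmetric] exponential_density_nonneg erlang_density_nonneg
          zero_le_one divide_nonneg_nonneg add_nonneg_nonneg)
  qed
  also have "\<dots> = ennreal (p / (1 + a)) * (\<integral>\<^sup>+r. ennreal (exponential_density (1 + a) r) \<partial>lborel)"
    by (rule nn_integral_cmult) measurable
  also have "(\<integral>\<^sup>+r. ennreal (exponential_density (1 + a) r) \<partial>lborel) = 1"
    using E.emeasure_space_1 unfolding exponential_law_def by (simp add: emeasure_density)
  finally show ?thesis by simp
qed

text \<open>
  This integral and the one in \<open>nn_integral_exponential_law\<close> add up to the total mass \<open>1\<close>.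
\<close>

lemma nn_integral_exponential_law_compl:
  assumes "0 \<le> a" "0 \<le> p" "p \<le> 1"
  shows "(\<integral>\<^sup>+r. ennreal (1 - exp (- r * a) * p) \<partial>exponential_law 1) = ennreal (1 - p / (1 + a))"
proof -
  interpret E: prob_space "exponential_law 1" by (rule prob_space_exponential_law) simp
  let ?I = "\<integral>\<^sup>+r. ennreal (1 - exp (- r * a) * p) \<partial>exponential_law 1"
  have nonneg: "AE r in exponential_law 1. 0 \<le> r"
    unfolding exponential_law_def by (subst AE_density) (auto simp: exponential_density_def)
  have "?I + ennreal (p / (1 + a)) = ?I + (\<integral>\<^sup>+r. ennreal (exp (- r * a) * p) \<partial>exponential_law 1)"
    unfolding nn_integral_exponential_law[OF assms(1,2)] ..
  also have "\<dots> = (\<integral>\<^sup>+r. ennreal (1 - exp (- r * a) * p) + ennreal (exp (- r * a) * p) \<partial>exponential_law 1)"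
    by (rule nn_integral_add[symmetric]) measurable
  also have "\<dots> = (\<integral>\<^sup>+r. 1 \<partial>exponential_law 1)"
  proof (rule nn_integral_cong_AE)
    show "AE r in exponential_law 1. ennreal (1 - exp (- r * a) * p) + ennreal (exp (- r * a) * p) = 1"
      using nonneg
    proof eventually_elim
      case (elim r)
      have "exp (- r * a) \<le> 1" using elim assms(1) by simp
      then have "exp (- r * a) * p \<le> 1" using assms by (intro mult_le_one) auto
      then show ?case using assms by (simp flip: ennreal_plus)
    qed
  qed
  also have "\<dots> = 1" using E.emeasure_space_1 by simp
  finally have "?I + ennreal (p / (1 + a)) = 1" .
  then have "?I = 1 - ennreal (p / (1 + a))"
    by (metis ennreal_add_diff_cancel_right ennreal_neq_top)
  also have "\<dots> = ennreal (1 - p / (1 + a))"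
    using assms by (simp add: ennreal_minus flip: ennreal_1)
  finally show ?thesis .
qed

lemma nn_integral_Beta:
  fixes a b :: real
  assumes "a > 0" "b > 0"
  shows "(\<integral>\<^sup>+t. ennreal (indicator {0<..<1} t * t powr (a - 1) * (1 - t) powr (b - 1)) \<partial>lborel) = ennreal (Beta a b)"
proof (rule nn_integral_has_integral_lborel)
  have "((\<lambda>t. t powr (a - 1) * (1 - t) powr (b - 1)) has_integral Beta a b) {0<..<1}"
    using has_integral_Beta_real[OF assms] by (simp add: has_integral_Icc_iff_Ioo)
  then show "((\<lambda>t. indicator {0<..<1} t * t powr (a - 1) * (1 - t) powr (b - 1)) has_integral Beta a b) UNIV"
    by (subst (asm) has_integral_restrict_UNIV[symmetric])
       (auto elim!: has_integral_eq[rotated] simp: indicator_def)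
qed auto

lemma Beta_pos: "a > 0 \<Longrightarrow> b > 0 \<Longrightarrow> Beta a b > (0::real)"
  by (simp add: Beta_def Gamma_real_pos)

lemma prob_space_beta_law:
  assumes "a > 0" "b > 0"
  shows "prob_space (beta_law a b)"
proof
  have "emeasure (beta_law a b) (space (beta_law a b)) =
     (\<integral>\<^sup>+t. ennreal (indicator {0<..<1} t * t powr (a - 1) * (1 - t) powr (b - 1)) * ennreal (1 / Beta a b) \<partial>lborel)"
    unfolding beta_law_def using Beta_pos[OF assms]
    by (simp add: emeasure_density ennreal_mult'[symmetric])
  also have "\<dots> = ennreal (Beta a b) * ennreal (1 / Beta a b)"
    by (subst nn_integral_multc) (auto simp: nn_integral_Beta assms)
  also have "\<dots> = 1"
    using Beta_pos[OF assms] by (simp add: ennreal_mult'[symmetric])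
  finally show "emeasure (beta_law a b) (space (beta_law a b)) = 1" .
qed

lemma sets_beta_law [simp, measurable_cong]: "sets (beta_law a b) = sets borel"
  and space_beta_law [simp]: "space (beta_law a b) = UNIV"
  by (auto simp: beta_law_def)

section \<open>Level and slope of a cap, and the intensity in these coordinates\<close>

text \<open>
  The ball that belongs to a point \<open>z = (x, \<rho>)\<close> with \<open>|x - x\<^sub>0| < \<rho>\<close> covers the vertical line above \<open>x\<^sub>0\<close>
  up to \<open>cap_height x0 z\<close>; its upper half is called the cap of \<open>z\<close>. High caps have small level, so that the
  highest cap is the first point on the scale of levels.
\<close>

definition cap_height :: "'a::euclidean_space \<Rightarrow> 'a \<times> real \<Rightarrow> real" where
  "cap_height x0 z = sqrt ((snd z)\<^sup>2 - (norm (fst z - x0))\<^sup>2)"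

definition cap_level :: "'a::euclidean_space \<Rightarrow> 'a \<times> real \<Rightarrow> real" where
  "cap_level x0 z = 1 / cap_height x0 z ^ DIM('a)"

definition cap_slope :: "'a::euclidean_space \<Rightarrow> 'a \<times> real \<Rightarrow> real" where
  "cap_slope x0 z = 1 - (norm (fst z - x0) / snd z)\<^sup>2"

definition strip :: "'a::euclidean_space \<Rightarrow> real \<Rightarrow> real \<Rightarrow> real set \<Rightarrow> ('a \<times> real) set" where
  "strip x0 a b C = {z. norm (fst z - x0) < snd z \<and> a < cap_level x0 z \<and> cap_level x0 z \<le> b \<and> cap_slope x0 z \<in> C}"

lemma borel_measurable_cap [measurable]:
  "cap_height x0 \<in> borel_measurable borel"
  "cap_level x0 \<in> borel_measurable borel"
  "cap_slope x0 \<in> borel_measurable borel"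
proof -
  have [measurable]: "cap_height x0 \<in> borel_measurable borel"
    unfolding cap_height_def borel_prod[symmetric] by measurable
  show "cap_height x0 \<in> borel_measurable borel" by measurable
  show "cap_level x0 \<in> borel_measurable borel"
    unfolding cap_level_def by measurable
  show "cap_slope x0 \<in> borel_measurable borel"
    unfolding cap_slope_def borel_prod[symmetric] by measurable
qed

lemma strip_borel [measurable]:
  assumes "C \<in> sets borel"
  shows "strip x0 a b C \<in> sets borel"
proof -
  have 1: "{z :: 'a \<times> real. norm (fst z - x0) < snd z} \<in> sets borel"
    by (intro borel_open open_Collect_less continuous_intros)
  have "strip x0 a b C = {z. norm (fst z - x0) < snd z} \<inter> cap_level x0 -` {a<..b} \<inter> cap_slope x0 -` C"
    by (auto simp: strip_def)
  also have "\<dots> \<in> sets borel"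
    by (intro sets.Int 1 measurable_sets_borel[OF borel_measurable_cap(2)]
        measurable_sets_borel[OF borel_measurable_cap(3)] assms) auto
  finally show ?thesis .
qed

text \<open>
  For \<open>p < 1\<close> the integrand is unbounded at \<open>1\<close>, so the fundamental theorem is applied on the open
  interval, with the primitive \<open>- (1 - t) powr p\<close> extended by its limit.
\<close>

lemma nn_integral_one_minus_powr:
  fixes p :: real
  assumes "p > 0" "\<tau> < 1" "\<tau> \<ge> 0"
  shows "(\<integral>\<^sup>+t. ennreal (indicator {\<tau><..<1} t * (p * (1 - t) powr (p - 1))) \<partial>lborel) = ennreal ((1 - \<tau>) powr p)"
proof -
  let ?f = "\<lambda>t. p * (1 - t) powr (p - 1)"
  let ?F = "\<lambda>t. - ((1 - t) powr p)"
  have lim: "((?F \<circ> real_of_ereal) \<longlongrightarrow> - ((1 - \<tau>) powr p)) (at_right (ereal \<tau>))"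
            "((?F \<circ> real_of_ereal) \<longlongrightarrow> 0) (at_left (ereal 1))"
  proof -
    have "((\<lambda>t. (1 - t) powr p) \<longlongrightarrow> (1 - 1) powr p) (at_left 1)"
      using assms by (intro tendsto_powr' tendsto_intros) (auto intro!: eventually_at_leftI[of 0])
    then show "((?F \<circ> real_of_ereal) \<longlongrightarrow> 0) (at_left (ereal 1))"
      unfolding ereal_tendsto_simps using tendsto_minus by fastforce
    show "((?F \<circ> real_of_ereal) \<longlongrightarrow> - ((1 - \<tau>) powr p)) (at_right (ereal \<tau>))"
      unfolding ereal_tendsto_simps using assms by (auto intro!: tendsto_intros)
  qed
  have der: "(?F has_real_derivative ?f x) (at x)" if "x < 1" for x
    using that by (auto intro!: derivative_eq_intros simp: powr_diff)
  have cont: "isCont ?f x" if "x < 1" for x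
    using that by (auto intro!: continuous_intros)
  have I: "set_integrable lborel (einterval \<tau> 1) ?f" "(LBINT x=ereal \<tau>..ereal 1. ?f x) = 0 - - ((1 - \<tau>) powr p)"
    using interval_integral_FTC_nonneg[of "ereal \<tau>" "ereal 1" ?F ?f, OF _ _ _ _ lim] assms der cont
    by (auto simp: one_ereal_def)
  have "(LBINT x=ereal \<tau>..ereal 1. ?f x) = integral\<^sup>L lborel (\<lambda>t. indicator {\<tau><..<1} t * ?f t)"
    using assms by (simp add: interval_lebesgue_integral_def set_lebesgue_integral_def mult.left_commute[where a=p])
  with I have "integral\<^sup>L lborel (\<lambda>t. indicator {\<tau><..<1} t * ?f t) = (1 - \<tau>) powr p" by simp
  moreover have "integrable lborel (\<lambda>t. indicator {\<tau><..<1} t * ?f t)"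
    using I(1) by (simp add: set_integrable_def one_ereal_def)
  ultimately show ?thesis
    using assms by (subst nn_integral_eq_integral) (auto simp: )
qed

lemma nn_integral_power_tail:
  fixes e :: real and n :: nat
  assumes "e > 0" "n > 0"
  shows "(\<integral>\<^sup>+\<rho>. ennreal (indicator {e..} \<rho> * \<rho> powr (- 1 - real n)) \<partial>lborel) = ennreal (1 / (real n * e ^ n))"
proof -
  let ?F = "\<lambda>\<rho>. - (\<rho> powr (- real n)) / real n"
  have "(\<integral>\<^sup>+\<rho>. ennreal (\<rho> powr (- 1 - real n)) * indicator {e..} \<rho> \<partial>lborel) = ennreal (0 - ?F e)"
  proof (rule nn_integral_FTC_atLeast)
    show "(?F has_real_derivative x powr (- 1 - real n)) (at x)" if "e \<le> x" for x
      using assms that by (auto intro!: derivative_eq_intros simp: powr_diff powr_minus field_simps)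
    show "(?F \<longlongrightarrow> 0) at_top"
    proof -
      have "((\<lambda>\<rho>. \<rho> powr (- real n)) \<longlongrightarrow> 0) at_top"
        using assms by (intro tendsto_neg_powr filterlim_ident) auto
      then have "((\<lambda>\<rho>. - (\<rho> powr (- real n)) / real n) \<longlongrightarrow> - 0 / real n) at_top"
        using assms by (intro tendsto_intros) auto
      then show ?thesis by simp
    qed
  qed auto
  also have "0 - ?F e = 1 / (real n * e ^ n)"
    using assms by (simp add: powr_minus powr_realpow field_simps)
  finally show ?thesis
    by (subst nn_integral_cong[where v="\<lambda>\<rho>. ennreal (\<rho> powr (- 1 - real n)) * indicator {e..} \<rho>"])
       (auto simp: indicator_def)
qed

text \<open>
  The slope exceeds \<open>\<tau>\<close> exactly on the concentric ball of radius \<open>\<rho> * sqrt (1 - \<tau>)\<close>, so the tail of the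
  image measure is the volume of a ball.
\<close>

lemma distr_slope_of_ball:
  fixes x0 :: "'a::euclidean_space"
  assumes "\<rho> > 0"
  defines "n \<equiv> DIM('a)"
  shows "distr (density lborel (indicator (ball x0 \<rho>))) borel (\<lambda>x. 1 - (norm (x - x0) / \<rho>)\<^sup>2) =
    density lborel (\<lambda>t. ennreal (unit_ball_vol n * \<rho> ^ n * (indicator {0<..<1} t * (real n / 2 * (1 - t) powr (real n / 2 - 1)))))"
    (is "?L = ?R")
proof (rule measure_eqI_lessThan)
  have n: "n > 0" unfolding n_def by simp
  have ind: "(indicator (ball x0 \<rho>) :: 'a \<Rightarrow> ennreal) \<in> borel_measurable borel"
    by (intro borel_measurable_indicator borel_open open_ball)
  have L: "emeasure ?L {\<tau><..} = ennreal (if \<tau> < 1 then unit_ball_vol n * \<rho> ^ n * (1 - max 0 \<tau>) powr (real n / 2) else 0)" for \<tau>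
  proof -
    have "emeasure ?L {\<tau><..} = emeasure lborel (ball x0 \<rho> \<inter> {x. \<tau> < 1 - (norm (x - x0) / \<rho>)\<^sup>2})"
    proof -
      have *: "(\<lambda>x. 1 - (norm (x - x0) / \<rho>)\<^sup>2) -` {\<tau><..} = {x. \<tau> < 1 - (norm (x - x0) / \<rho>)\<^sup>2}"
        by auto
      have S: "{x. \<tau> < 1 - (norm (x - x0) / \<rho>)\<^sup>2} \<in> sets borel"
        using assms by (intro borel_open open_Collect_less continuous_intros) auto
      have "emeasure ?L {\<tau><..} = emeasure (density lborel (indicator (ball x0 \<rho>))) {x. \<tau> < 1 - (norm (x - x0) / \<rho>)\<^sup>2}"
        by (subst emeasure_distr) (auto simp: *)
      also have "\<dots> = (\<integral>\<^sup>+x. indicator (ball x0 \<rho> \<inter> {x. \<tau> < 1 - (norm (x - x0) / \<rho>)\<^sup>2}) x \<partial>lborel)"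
        using S ind by (subst emeasure_density) (auto intro!: nn_integral_cong simp: indicator_def simp del: nn_integral_indicator)
      also have "\<dots> = emeasure lborel (ball x0 \<rho> \<inter> {x. \<tau> < 1 - (norm (x - x0) / \<rho>)\<^sup>2})"
        using S by (intro nn_integral_indicator sets.Int) auto
      finally show ?thesis .
    qed
    also have "ball x0 \<rho> \<inter> {x. \<tau> < 1 - (norm (x - x0) / \<rho>)\<^sup>2} =
       (if \<tau> < 1 then ball x0 (\<rho> * sqrt (1 - max 0 \<tau>)) else {})" (is "?A = ?B")
    proof -
      have "x \<in> ?A \<longleftrightarrow> x \<in> ?B" for x
      proof -
        define r where "r = norm (x - x0) / \<rho>"
        have r0: "r \<ge> 0" using assms by (simp add: r_def)
        have 1: "x \<in> ball x0 \<rho> \<longleftrightarrow> r < 1"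
          using assms by (simp add: r_def dist_norm norm_minus_commute field_simps)
        have 2: "x \<in> ball x0 (\<rho> * sqrt (1 - max 0 \<tau>)) \<longleftrightarrow> r < sqrt (1 - max 0 \<tau>)"
          using assms by (simp add: r_def dist_norm norm_minus_commute field_simps)
        have 3: "r < sqrt (1 - max 0 \<tau>) \<longleftrightarrow> r\<^sup>2 < 1 - max 0 \<tau>"
          using r0 by (metis not_le real_sqrt_le_iff real_sqrt_abs abs_of_nonneg)
        have 4: "r < 1 \<longleftrightarrow> r\<^sup>2 < 1"
          using r0 by (simp add: power_less_one_iff)
        have 5: "x \<in> ?A \<longleftrightarrow> r\<^sup>2 < 1 \<and> \<tau> < 1 - r\<^sup>2"
          using 1 4 by (simp add: r_def)
        have "0 \<le> r\<^sup>2" by simp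
        show ?thesis
        proof (cases "\<tau> < 1")
          case True
          then show ?thesis unfolding 5 using 2 3 by (auto simp: max_def)
        next
          case False
          then have "\<not> \<tau> < 1 - r\<^sup>2" using \<open>0 \<le> r\<^sup>2\<close> by linarith
          then show ?thesis unfolding 5 using False by simp
        qed
      qed
      then show ?thesis by blast
    qed
    also have "emeasure lborel \<dots> = ennreal (if \<tau> < 1 then unit_ball_vol n * \<rho> ^ n * (1 - max 0 \<tau>) powr (real n / 2) else 0)"
      using assms by (auto simp: emeasure_ball power_mult_distrib powr_half_sqrt[symmetric] powr_powr powr_realpow[symmetric] powr_power n_def)
    finally show ?thesis .
  qed
  have R: "emeasure ?R {\<tau><..} = ennreal (if \<tau> < 1 then unit_ball_vol n * \<rho> ^ n * (1 - max 0 \<tau>) powr (real n / 2) else 0)" for \<tau>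
  proof -
    have "emeasure ?R {\<tau><..} = (\<integral>\<^sup>+t. ennreal (unit_ball_vol n * \<rho> ^ n) *
        ennreal (indicator {max 0 \<tau><..<1} t * (real n / 2 * (1 - t) powr (real n / 2 - 1))) \<partial>lborel)"
      using assms by (subst emeasure_density) (auto intro!: nn_integral_cong simp: ennreal_mult'[symmetric] indicator_def)
    also have "\<dots> = ennreal (unit_ball_vol n * \<rho> ^ n) *
       (\<integral>\<^sup>+t. ennreal (indicator {max 0 \<tau><..<1} t * (real n / 2 * (1 - t) powr (real n / 2 - 1))) \<partial>lborel)"
      by (rule nn_integral_cmult) auto
    also have "\<dots> = ennreal (if \<tau> < 1 then unit_ball_vol n * \<rho> ^ n * (1 - max 0 \<tau>) powr (real n / 2) else 0)"
      using n assms nn_integral_one_minus_powr[of "real n / 2" "max 0 \<tau>"]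
      by (auto simp: ennreal_mult')
    finally show ?thesis .
  qed
  show "emeasure ?L {\<tau><..} = emeasure ?R {\<tau><..}" for \<tau> unfolding L R ..
  show "emeasure ?L {\<tau><..} < \<infinity>" for \<tau> unfolding L by simp
qed auto

lemma nn_integral_slope_of_ball:
  fixes x0 :: "'a::euclidean_space"
  assumes "\<rho> > 0" and [measurable]: "f \<in> borel_measurable borel"
  defines "n \<equiv> DIM('a)"
  shows "(\<integral>\<^sup>+x. indicator (ball x0 \<rho>) x * f (1 - (norm (x - x0) / \<rho>)\<^sup>2) \<partial>lborel) =
    (\<integral>\<^sup>+t. ennreal (unit_ball_vol n * \<rho> ^ n * (indicator {0<..<1} t * (real n / 2 * (1 - t) powr (real n / 2 - 1)))) * f t \<partial>lborel)"
proof -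
  have ind: "(indicator (ball x0 \<rho>) :: 'a \<Rightarrow> ennreal) \<in> borel_measurable borel"
    by (intro borel_measurable_indicator borel_open open_ball)
  have "(\<integral>\<^sup>+x. indicator (ball x0 \<rho>) x * f (1 - (norm (x - x0) / \<rho>)\<^sup>2) \<partial>lborel) =
     (\<integral>\<^sup>+x. f (1 - (norm (x - x0) / \<rho>)\<^sup>2) \<partial>density lborel (indicator (ball x0 \<rho>)))"
    using ind by (subst nn_integral_density) auto
  also have "\<dots> = (\<integral>\<^sup>+t. f t \<partial>distr (density lborel (indicator (ball x0 \<rho>))) borel (\<lambda>x. 1 - (norm (x - x0) / \<rho>)\<^sup>2))"
    by (subst nn_integral_distr) auto
  also have "\<dots> = (\<integral>\<^sup>+t. ennreal (unit_ball_vol n * \<rho> ^ n * (indicator {0<..<1} t * (real n / 2 * (1 - t) powr (real n / 2 - 1)))) * f t \<partial>lborel)"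
    unfolding distr_slope_of_ball[OF assms(1)] n_def
    by (subst nn_integral_density) auto
  finally show ?thesis .
qed

lemma Gamma_real_duplication:
  assumes "x > (0::real)"
  shows "Gamma x * Gamma (x + 1/2) = 2 powr (1 - 2 * x) * sqrt pi * Gamma (2 * x)"
proof -
  have nonpos: "complex_of_real y \<notin> \<int>\<^sub>\<le>\<^sub>0" if "y > 0" for y
    using that by (auto elim!: nonpos_Ints_cases simp: complex_eq_iff)
  have half: "complex_of_real x + 1 / 2 = complex_of_real (x + 1 / 2)"
    and double: "2 * complex_of_real x = complex_of_real (2 * x)"
    and exp: "exp ((1 - 2 * complex_of_real x) * of_real (ln 2)) = of_real (exp ((1 - 2 * x) * ln 2))"
    by (simp_all add: exp_of_real[symmetric])
  have "complex_of_real (Gamma x * Gamma (x + 1/2)) = of_real (exp ((1 - 2 * x) * ln 2) * sqrt pi * Gamma (2 * x))"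
    using Gamma_legendre_duplication[of "complex_of_real x"] nonpos[of x] nonpos[of "x + 1/2"] assms
    unfolding exp unfolding half double Gamma_complex_of_real by (simp only: of_real_mult) blast
  then have "Gamma x * Gamma (x + 1/2) = exp ((1 - 2 * x) * ln 2) * sqrt pi * Gamma (2 * x)"
    by (rule injD[OF inj_of_real])
  then show ?thesis by (simp add: powr_def)
qed

text \<open>
  The constant in the intensity expressed through the volume of the unit ball and the normalisation of
  the beta law; this is what makes the rate of the levels equal to \<open>s\<close>.
\<close>

lemma c_const_Suc:
  assumes "n > 0"
  shows "c_const (Suc n) = real n * unit_ball_vol n * Beta (real n / 2 + 1) (real n / 2)"
proof -
  define x where "x = real n / 2"
  have x: "x > 0" using assms by (simp add: x_def)
  have G: "Gamma x > 0" "Gamma (x + 1/2) > 0" "Gamma (2*x) > 0" "Gamma (x+1) > 0"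
    using x by (auto intro!: Gamma_real_pos)
  have N: "Gamma x \<noteq> 0" "Gamma (x + 1/2) \<noteq> 0" "Gamma (2*x) \<noteq> 0" "Gamma (x+1) \<noteq> 0"
    using G by linarith+
  have G2: "Gamma (2 * x + 1) = 2 * x * Gamma (2 * x)"
  proof -
    have "2 * x \<notin> \<int>\<^sub>\<le>\<^sub>0" using x by (auto elim!: nonpos_Ints_cases)
    from Gamma_plus1[OF this] show ?thesis .
  qed
  have "c_const (Suc n) = 2 powr (1 - 2 * x) * sqrt pi * pi powr x / Gamma (x + 1/2)"
  proof -
    have 1: "2 - real (Suc n) = 1 - 2 * x" and 2: "real (Suc n) / 2 = x + 1/2"
      by (simp_all add: x_def field_simps)
    show ?thesis unfolding c_const_def 1 2 powr_add by (simp add: powr_half_sqrt)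
  qed
  also have "2 powr (1 - 2 * x) * sqrt pi = Gamma x * Gamma (x + 1/2) / Gamma (2 * x)"
    using Gamma_real_duplication[OF x] G by (simp add: field_simps)
  finally have "c_const (Suc n) = pi powr x * Gamma x / Gamma (2 * x)" using G by simp
  also have "\<dots> = 2 * x * (pi powr x / Gamma (x + 1)) * (Gamma (x + 1) * Gamma x / Gamma (2 * x + 1))"
    unfolding G2 using N x by (simp add: divide_simps)
  also have "\<dots> = real n * unit_ball_vol n * Beta (real n / 2 + 1) (real n / 2)"
    by (simp add: unit_ball_vol_def Beta_def x_def algebra_simps)
  finally show ?thesis .
qed

lemma cap_height_eq:
  assumes "x \<in> ball x0 (\<rho>::real)" "\<rho> > 0"
  defines "t \<equiv> 1 - (norm (x - x0) / \<rho>)\<^sup>2"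
  shows "0 < t" "cap_height x0 (x, \<rho>) = \<rho> * sqrt t"
proof -
  have r: "norm (x - x0) < \<rho>" using assms by (simp add: dist_norm norm_minus_commute)
  then have "norm (x - x0) / \<rho> < 1" using assms by simp
  then show "0 < t" using assms(2) unfolding t_def
    by (simp add: power_less_one_iff)
  have "(\<rho> * sqrt t)\<^sup>2 = \<rho>\<^sup>2 - (norm (x - x0))\<^sup>2"
    using \<open>0 < t\<close> assms(2) by (simp add: power_mult_distrib) (simp add: t_def field_simps)
  then show "cap_height x0 (x, \<rho>) = \<rho> * sqrt t"
    using \<open>0 < t\<close> assms(2) unfolding cap_height_def by (simp add: real_sqrt_unique)
qed

lemma powr_mult_power:
  fixes \<rho> :: real
  assumes "\<rho> > 0"
  shows "\<rho> powr (- 1 - 2 * real n) * \<rho> ^ n = \<rho> powr (- 1 - real n)"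
proof -
  have "\<rho> powr (- 1 - real n) = \<rho> powr ((- 1 - 2 * real n) + real n)" by (simp add: algebra_simps)
  also have "\<dots> = \<rho> powr (- 1 - 2 * real n) * \<rho> ^ n"
    by (simp only: powr_add powr_realpow[OF assms])
  finally show ?thesis ..
qed

lemma sets_cell_intensity [simp, measurable_cong]: "sets (cell_intensity d s) = sets borel"
  by (simp add: cell_intensity_def)

text \<open>
  For fixed \<open>\<rho>\<close> the integral over \<open>x\<close> is one over the slope \<open>t\<close> by \<open>nn_integral_slope_of_ball\<close>. The cap has
  height \<open>\<rho> * sqrt t\<close>, so for fixed \<open>t\<close> the condition on the level is a lower bound on \<open>\<rho>\<close>. After exchanging the
  integrals the one over \<open>\<rho>\<close> is a power tail that equals \<open>b * t powr (n / 2) / n\<close>.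
\<close>

lemma emeasure_strip_0:
  fixes x0 :: "'a::euclidean_space"
  assumes s: "s > 0" and b: "b \<ge> 0" and [measurable]: "C \<in> sets borel"
  defines "n \<equiv> DIM('a)"
  shows "emeasure (cell_intensity (Suc n) s) (strip x0 0 b C) =
    ennreal (s * b) * emeasure (beta_law (real n / 2 + 1) (real n / 2)) C"
proof -
  have n: "n > 0" by (simp add: n_def)
  define k where "k = 2 * (real n / c_const (Suc n)) * s"
  have kpos: "k \<ge> 0" using s n c_const_Suc[OF n] Beta_pos[of "real n / 2 + 1" "real n / 2"] by (simp add: k_def)
  define f :: "'a \<times> real \<Rightarrow> ennreal" where
    "f = (\<lambda>(x, \<rho>). ennreal (indicator {0<..} \<rho> * (k * \<rho> powr (- 1 - 2 * real n))))"
  have [measurable]: "f \<in> borel_measurable borel"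
    unfolding f_def borel_prod[symmetric] by measurable
  have f: "cell_intensity (Suc n) s = density lborel f"
    by (simp add: cell_intensity_def f_def k_def)
  define g :: "real \<Rightarrow> real \<Rightarrow> ennreal" where
    "g = (\<lambda>\<rho> t. indicator C t * (if 1 \<le> b * (\<rho> * sqrt t) ^ n then 1 else 0))"
  have [measurable]: "(\<lambda>(\<rho>, t). g \<rho> t) \<in> borel_measurable (borel \<Otimes>\<^sub>M borel)"
    unfolding g_def by measurable
  have [measurable]: "g \<rho> \<in> borel_measurable borel" for \<rho>
    unfolding g_def by measurable
  define q :: "real \<Rightarrow> real" where "q = (\<lambda>t. indicator {0<..<1} t * (real n / 2 * (1 - t) powr (real n / 2 - 1)))"
  have [measurable]: "q \<in> borel_measurable borel" unfolding q_def by measurable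
  have q0: "q t \<ge> 0" for t by (simp add: q_def indicator_def)
  define w where "w = unit_ball_vol n"
  have w0: "w > 0" by (simp add: w_def)
  have "emeasure (cell_intensity (Suc n) s) (strip x0 0 b C) = (\<integral>\<^sup>+z. f z * indicator (strip x0 0 b C) z \<partial>lborel)"
    unfolding f by (rule emeasure_density) auto
  also have "\<dots> = (\<integral>\<^sup>+\<rho>. \<integral>\<^sup>+x. f (x, \<rho>) * indicator (strip x0 0 b C) (x, \<rho>) \<partial>lborel \<partial>lborel)"
  proof -
    have "(\<lambda>z. f z * indicator (strip x0 0 b C) z) \<in> borel_measurable (lborel \<Otimes>\<^sub>M lborel)"
      unfolding lborel_prod by measurable
    then have "(\<lambda>(x, \<rho>). f (x, \<rho>) * indicator (strip x0 0 b C) (x, \<rho>)) \<in> borel_measurable (lborel \<Otimes>\<^sub>M lborel)"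
      by (simp add: case_prod_unfold)
    from lborel_pair.nn_integral_snd[OF this] show ?thesis
      unfolding lborel_prod by (simp add: case_prod_unfold)
  qed
  also have "\<dots> = (\<integral>\<^sup>+\<rho>. \<integral>\<^sup>+t. ennreal (indicator {0<..} \<rho> * (k * w * q t * \<rho> powr (- 1 - real n))) * g \<rho> t \<partial>lborel \<partial>lborel)"
  proof (rule nn_integral_cong)
    fix \<rho> :: real
    show "(\<integral>\<^sup>+x. f (x, \<rho>) * indicator (strip x0 0 b C) (x, \<rho>) \<partial>lborel) =
      (\<integral>\<^sup>+t. ennreal (indicator {0<..} \<rho> * (k * w * q t * \<rho> powr (- 1 - real n))) * g \<rho> t \<partial>lborel)"
    proof (cases "\<rho> > 0")
      case True
      have ind: "indicator (strip x0 0 b C) (x, \<rho>) = (indicator (ball x0 \<rho>) x * g \<rho> (1 - (norm (x - x0) / \<rho>)\<^sup>2) :: ennreal)" for x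
      proof (cases "x \<in> ball x0 \<rho>")
        case in_ball: True
        note l = cap_height_eq[OF this True]
        have "cap_level x0 (x, \<rho>) > 0" using l True by (simp add: cap_level_def)
        moreover have "cap_level x0 (x, \<rho>) \<le> b \<longleftrightarrow> 1 \<le> b * (\<rho> * sqrt (1 - (norm (x - x0) / \<rho>)\<^sup>2)) ^ n"
          using l True by (simp add: cap_level_def n_def divide_le_eq)
        ultimately show ?thesis using in_ball
          by (auto simp: strip_def g_def indicator_def cap_slope_def dist_norm norm_minus_commute)
      qed (auto simp: strip_def dist_norm norm_minus_commute)
      have [measurable]: "(indicator (ball x0 \<rho>) :: 'a \<Rightarrow> ennreal) \<in> borel_measurable borel"
        by (intro borel_measurable_indicator borel_open open_ball)
      have "(\<integral>\<^sup>+x. f (x, \<rho>) * indicator (strip x0 0 b C) (x, \<rho>) \<partial>lborel) =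
        (\<integral>\<^sup>+x. ennreal (k * \<rho> powr (- 1 - 2 * real n)) * (indicator (ball x0 \<rho>) x * g \<rho> (1 - (norm (x - x0) / \<rho>)\<^sup>2)) \<partial>lborel)"
        using True by (simp add: f_def ind)
      also have "\<dots> = ennreal (k * \<rho> powr (- 1 - 2 * real n)) * (\<integral>\<^sup>+x. (indicator (ball x0 \<rho>) x * g \<rho> (1 - (norm (x - x0) / \<rho>)\<^sup>2)) \<partial>lborel)"
        by (rule nn_integral_cmult) measurable
      also have "\<dots> = ennreal (k * \<rho> powr (- 1 - 2 * real n)) * (\<integral>\<^sup>+t. ennreal (w * \<rho> ^ n * q t) * g \<rho> t \<partial>lborel)"
        by (subst nn_integral_slope_of_ball[OF True]) (simp_all add: n_def w_def q_def)
      also have "\<dots> = (\<integral>\<^sup>+t. ennreal (k * \<rho> powr (- 1 - 2 * real n)) * (ennreal (w * \<rho> ^ n * q t) * g \<rho> t) \<partial>lborel)"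
        by (rule nn_integral_cmult[symmetric]) measurable
      also have "\<dots> = (\<integral>\<^sup>+t. ennreal (indicator {0<..} \<rho> * (k * w * q t * \<rho> powr (- 1 - real n))) * g \<rho> t \<partial>lborel)"
      proof (rule nn_integral_cong)
        fix t :: real
        have "k * \<rho> powr (- 1 - 2 * real n) * (w * \<rho> ^ n * q t) = k * w * q t * \<rho> powr (- 1 - real n)"
          unfolding powr_mult_power[OF True, symmetric] by simp
        then show "ennreal (k * \<rho> powr (- 1 - 2 * real n)) * (ennreal (w * \<rho> ^ n * q t) * g \<rho> t) =
           ennreal (indicator {0<..} \<rho> * (k * w * q t * \<rho> powr (- 1 - real n))) * g \<rho> t"
          using True kpos ennreal_mult'[of "k * \<rho> powr (- 1 - 2 * real n)" "w * \<rho> ^ n * q t"]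
          by (simp only: mult.assoc[symmetric]) (simp add: mult.assoc)
      qed
      finally show ?thesis .
    qed (simp add: f_def)
  qed
  also have "\<dots> = (\<integral>\<^sup>+t. \<integral>\<^sup>+\<rho>. ennreal (indicator {0<..} \<rho> * (k * w * q t * \<rho> powr (- 1 - real n))) * g \<rho> t \<partial>lborel \<partial>lborel)"
    by (rule lborel_pair.Fubini'[symmetric]) measurable
  also have "\<dots> = (\<integral>\<^sup>+t. ennreal (k * w * q t * (b * t powr (real n / 2) / real n)) * indicator C t \<partial>lborel)"
  proof (rule nn_integral_cong)
    fix t :: real
    show "(\<integral>\<^sup>+\<rho>. ennreal (indicator {0<..} \<rho> * (k * w * q t * \<rho> powr (- 1 - real n))) * g \<rho> t \<partial>lborel) =
      ennreal (k * w * q t * (b * t powr (real n / 2) / real n)) * indicator C t"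
    proof (cases "t \<in> {0<..<1} \<and> b > 0")
      case True
      \<comment> \<open>The radius at which a cap of slope \<open>t\<close> has level \<open>b\<close>.\<close>
      define e where "e = 1 / (root n b * sqrt t)"
      have e: "e > 0" using True n by (simp add: e_def)
      have en: "e ^ n = 1 / (b * t powr (real n / 2))"
        using True n by (simp add: e_def power_divide power_mult_distrib powr_half_sqrt[symmetric] powr_power)
      have iff: "1 \<le> b * (\<rho> * sqrt t) ^ n \<longleftrightarrow> e \<le> \<rho>" if "\<rho> > 0" for \<rho>
      proof -
        have "e \<le> \<rho> \<longleftrightarrow> e ^ n \<le> \<rho> ^ n" using e that n by simp
        also have "\<dots> \<longleftrightarrow> 1 \<le> b * (\<rho> * sqrt t) ^ n"
          using True unfolding en
          by (simp add: power_mult_distrib powr_half_sqrt[symmetric] powr_power divide_le_eq mult_ac)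
        finally show ?thesis ..
      qed
      have "(\<integral>\<^sup>+\<rho>. ennreal (indicator {0<..} \<rho> * (k * w * q t * \<rho> powr (- 1 - real n))) * g \<rho> t \<partial>lborel) =
        (\<integral>\<^sup>+\<rho>. ennreal (k * w * q t) * indicator C t * ennreal (indicator {e..} \<rho> * \<rho> powr (- 1 - real n)) \<partial>lborel)"
        using kpos w0 q0[of t] e
        by (intro nn_integral_cong) (auto simp: g_def iff indicator_def ennreal_mult'[symmetric])
      also have "\<dots> = ennreal (k * w * q t) * indicator C t * ennreal (1 / (real n * e ^ n))"
        by (subst nn_integral_cmult) (use nn_integral_power_tail[OF e n] in auto)
      also have "\<dots> = ennreal (k * w * q t * (b * t powr (real n / 2) / real n)) * indicator C t"
        using kpos w0 q0[of t] b by (auto simp: en indicator_def ennreal_mult'[symmetric])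
      finally show ?thesis .
    next
      case False
      then have "q t = 0 \<or> b = 0" using b by (auto simp: q_def)
      then show ?thesis by (auto simp: g_def)
    qed
  qed
  also have "\<dots> = (\<integral>\<^sup>+t. ennreal (s * b) * (ennreal (indicator {0<..<1} t * t powr (real n / 2 + 1 - 1) * (1 - t) powr (real n / 2 - 1) / Beta (real n / 2 + 1) (real n / 2)) * indicator C t) \<partial>lborel)"
  proof (rule nn_integral_cong)
    fix t :: real
    define B where "B = Beta (real n / 2 + 1) (real n / 2)"
    have B: "B > 0" unfolding B_def using n by (intro Beta_pos) auto
    have "k = 2 * s / (w * B)" using n B by (simp add: k_def c_const_Suc w_def B_def)
    define y where "y = indicator {0<..<1} t * t powr (real n / 2 + 1 - 1) * (1 - t) powr (real n / 2 - 1) / B"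
    have "k * w * q t * (b * t powr (real n / 2) / real n) = s * b * y"
      using \<open>k = 2 * s / (w * B)\<close> w0 B n by (simp add: q_def y_def)
    moreover have "ennreal (s * b * y) = ennreal (s * b) * ennreal y"
      using s b by (intro ennreal_mult') simp
    ultimately show "ennreal (k * w * q t * (b * t powr (real n / 2) / real n)) * indicator C t =
       ennreal (s * b) * (ennreal (indicator {0<..<1} t * t powr (real n / 2 + 1 - 1) * (1 - t) powr (real n / 2 - 1) / Beta (real n / 2 + 1) (real n / 2)) * indicator C t)"
      unfolding B_def[symmetric] y_def[symmetric] by (simp only: mult.assoc)
  qed
  also have "\<dots> = ennreal (s * b) * emeasure (beta_law (real n / 2 + 1) (real n / 2)) C"
    unfolding beta_law_def by (subst nn_integral_cmult) (simp_all add: emeasure_density)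
  finally show ?thesis .
qed

lemma emeasure_strip:
  fixes x0 :: "'a::euclidean_space"
  assumes s: "s > 0" and ab: "0 \<le> a" "a \<le> b" and C [measurable]: "C \<in> sets borel"
  defines "n \<equiv> DIM('a)"
  shows "emeasure (cell_intensity (Suc n) s) (strip x0 a b C) =
    ennreal (s * (b - a)) * emeasure (beta_law (real n / 2 + 1) (real n / 2)) C"
proof -
  interpret B: prob_space "beta_law (real n / 2 + 1) (real n / 2)"
    by (rule prob_space_beta_law) (auto simp: n_def)
  let ?m = "cell_intensity (Suc n) s :: ('a \<times> real) measure"
  have eq: "strip x0 a b C = strip x0 0 b C - strip x0 0 a C"
    using ab by (auto simp: strip_def)
  have e: "emeasure ?m (strip x0 0 b C) = ennreal (s * b * B.prob C)" if "b \<ge> 0" for b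
    unfolding n_def using emeasure_strip_0[OF s that C, of x0] s that
    by (simp add: n_def[symmetric] B.emeasure_eq_measure ennreal_mult')
  have "emeasure ?m (strip x0 a b C) = emeasure ?m (strip x0 0 b C) - emeasure ?m (strip x0 0 a C)"
    unfolding eq
  proof (rule emeasure_Diff)
    show "strip x0 0 a C \<subseteq> strip x0 0 b C" using ab by (auto simp: strip_def)
  qed (use ab in \<open>simp_all add: e strip_borel\<close>)
  also have "\<dots> = ennreal (s * b * B.prob C - s * a * B.prob C)"
    using ab s by (simp add: e ennreal_minus)
  also have "\<dots> = ennreal (s * (b - a)) * emeasure (beta_law (real n / 2 + 1) (real n / 2)) C"
    unfolding B.emeasure_eq_measure using ab s
    by (subst ennreal_mult'[symmetric]) (simp_all add: algebra_simps)
  finally show ?thesis .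
qed

text \<open>
  Every ball that comes within distance \<open>e\<close> of a point at height \<open>2 * e\<close> above \<open>x\<^sub>0\<close> belongs to
  \<open>wide_cone x0 e\<close>. As this set has finite intensity, only finitely many balls can shape the boundary of the
  cell near such a point. Local finiteness of the configuration does not give this, since \<open>wide_cone x0 e\<close> is
  not relatively compact.
\<close>

definition wide_cone :: "'a::euclidean_space \<Rightarrow> real \<Rightarrow> ('a \<times> real) set" where
  "wide_cone x0 e = {z. norm (fst z - x0) < 2 * snd z \<and> e \<le> snd z}"

lemma wide_cone_borel [measurable]: "wide_cone x0 e \<in> sets borel"
proof -
  have "wide_cone x0 e = {z. norm (fst z - x0) < 2 * snd z} \<inter> {z. e \<le> snd z}"
    by (auto simp: wide_cone_def)
  also have "\<dots> \<in> sets borel"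
    by (intro sets.Int borel_open[OF open_Collect_less] borel_closed[OF closed_Collect_le] continuous_intros)
  finally show ?thesis .
qed

lemma emeasure_wide_cone_finite:
  fixes x0 :: "'a::euclidean_space"
  assumes e: "e > 0" and s: "s > 0"
  shows "emeasure (cell_intensity (Suc DIM('a)) s) (wide_cone x0 e) < \<infinity>"
proof -
  define n where "n = DIM('a)"
  have n: "n > 0" by (simp add: n_def)
  define k where "k = 2 * (real n / c_const (Suc n)) * s"
  have kpos: "k \<ge> 0" using s n c_const_Suc[OF n] Beta_pos[of "real n / 2 + 1" "real n / 2"] by (simp add: k_def)
  define f :: "'a \<times> real \<Rightarrow> ennreal" where
    "f = (\<lambda>(x, \<rho>). ennreal (indicator {0<..} \<rho> * (k * \<rho> powr (- 1 - 2 * real n))))"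
  have [measurable]: "f \<in> borel_measurable borel"
    unfolding f_def borel_prod[symmetric] by measurable
  have "cell_intensity (Suc n) s = density lborel f"
    by (simp add: cell_intensity_def f_def k_def)
  then have "emeasure (cell_intensity (Suc n) s) (wide_cone x0 e) = (\<integral>\<^sup>+z. f z * indicator (wide_cone x0 e) z \<partial>lborel)"
    by (simp add: emeasure_density)
  also have "\<dots> = (\<integral>\<^sup>+\<rho>. \<integral>\<^sup>+x. f (x, \<rho>) * indicator (wide_cone x0 e) (x, \<rho>) \<partial>lborel \<partial>lborel)"
  proof -
    have "(\<lambda>z. f z * indicator (wide_cone x0 e) z) \<in> borel_measurable (lborel \<Otimes>\<^sub>M lborel)"
      unfolding lborel_prod by measurable
    then have "(\<lambda>(x, \<rho>). f (x, \<rho>) * indicator (wide_cone x0 e) (x, \<rho>)) \<in> borel_measurable (lborel \<Otimes>\<^sub>M lborel)"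
      by (simp add: case_prod_unfold)
    from lborel_pair.nn_integral_snd[OF this] show ?thesis
      unfolding lborel_prod by (simp add: case_prod_unfold)
  qed
  also have "\<dots> = (\<integral>\<^sup>+\<rho>. ennreal (k * unit_ball_vol n * 2 ^ n) * ennreal (indicator {e..} \<rho> * \<rho> powr (- 1 - real n)) \<partial>lborel)"
  proof (rule nn_integral_cong)
    fix \<rho> :: real
    have "(\<integral>\<^sup>+x. f (x, \<rho>) * indicator (wide_cone x0 e) (x, \<rho>) \<partial>lborel) =
      (\<integral>\<^sup>+x. ennreal (indicator {e..} \<rho> * (k * \<rho> powr (- 1 - 2 * real n))) * indicator (ball x0 (2 * \<rho>)) x \<partial>lborel)"
      using e by (intro nn_integral_cong) (auto simp: f_def wide_cone_def indicator_def dist_norm norm_minus_commute)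
    also have "\<dots> = ennreal (indicator {e..} \<rho> * (k * \<rho> powr (- 1 - 2 * real n))) * emeasure lborel (ball x0 (2 * \<rho>))"
      by (rule nn_integral_cmult_indicator) auto
    also have "\<dots> = ennreal (k * unit_ball_vol n * 2 ^ n) * ennreal (indicator {e..} \<rho> * \<rho> powr (- 1 - real n))"
    proof (cases "e \<le> \<rho>")
      case True
      then have \<rho>: "\<rho> > 0" using e by simp
      have "\<rho> powr (- 1 - 2 * real n) * \<rho> ^ n = \<rho> powr (- 1 - real n)"
        by (rule powr_mult_power[OF \<rho>])
      then have "k * \<rho> powr (- 1 - 2 * real n) * (unit_ball_vol n * (2 * \<rho>) ^ n) = k * unit_ball_vol n * 2 ^ n * \<rho> powr (- 1 - real n)"
        by (simp add: power_mult_distrib)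
      then show ?thesis using \<rho> True
        by (simp add: emeasure_ball n_def[symmetric] kpos ennreal_mult'[symmetric])
    qed auto
    finally show "(\<integral>\<^sup>+x. f (x, \<rho>) * indicator (wide_cone x0 e) (x, \<rho>) \<partial>lborel) = \<dots>" .
  qed
  also have "\<dots> = ennreal (k * unit_ball_vol n * 2 ^ n) * ennreal (1 / (real n * e ^ n))"
    by (subst nn_integral_cmult) (use nn_integral_power_tail[OF e n] in auto)
  also have "\<dots> < \<infinity>" by (simp add: ennreal_mult_less_top)
  finally show ?thesis unfolding n_def .
qed

section \<open>Height and angle of the cell in terms of the highest cap\<close>

lemma frontier_local:
  assumes U: "open U" and eq: "A \<inter> U = B \<inter> U"
  shows "frontier A \<inter> U = frontier B \<inter> U"
proof -
  have *: "closure A \<inter> U \<subseteq> closure B" if "A \<inter> U = B \<inter> U" for A B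
  proof -
    have "U \<inter> closure A \<subseteq> closure (U \<inter> A)" by (rule open_Int_closure_subset[OF U])
    also have "\<dots> = closure (U \<inter> B)" using that by (simp add: Int_commute)
    also have "\<dots> \<subseteq> closure B" by (intro closure_mono) auto
    finally show ?thesis by auto
  qed
  have "(- A) \<inter> U = (- B) \<inter> U" using eq by auto
  from *[OF this] *[OF this[symmetric]] *[OF eq] *[OF eq[symmetric]] show ?thesis
    unfolding frontier_closures by blast
qed

lemma orthogonal_to_hypersurface_local:
  assumes "open U" "p \<in> U" "S \<inter> U = T \<inter> U"
  shows "orthogonal_to_hypersurface S p n \<longleftrightarrow> orthogonal_to_hypersurface T p n"
proof -
  have "at p within S = at p within T"
    using assms by (intro at_within_nhd[of p U]) auto
  then show ?thesis by (simp add: orthogonal_to_hypersurface_def)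
qed

lemma orthogonal_to_sphere_radius:
  fixes c p :: "'b::euclidean_space"
  assumes "dist c p = r" "r > 0"
  shows "orthogonal_to_hypersurface (sphere c r) p (p - c)"
  unfolding orthogonal_to_hypersurface_def
proof
  show "p - c \<noteq> 0" using assms by auto
  have "\<forall>\<^sub>F q in at p within sphere c r. - norm (q - p) / 2 = (p - c) \<bullet> (q - p) / norm (q - p)"
    unfolding eventually_at_filter
  proof (intro always_eventually allI impI)
    fix q assume q: "q \<noteq> p" "q \<in> sphere c r"
    have "(q - c) \<bullet> (q - c) = (p - c) \<bullet> (p - c)"
      using q assms by (simp add: dot_square_norm dist_norm norm_minus_commute)
    moreover have "(q - c) \<bullet> (q - c) = (p - c) \<bullet> (p - c) + 2 * ((p - c) \<bullet> (q - p)) + (q - p) \<bullet> (q - p)"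
      by (simp add: inner_diff_left inner_diff_right inner_commute)
    ultimately have "(p - c) \<bullet> (q - p) = - (norm (q - p))\<^sup>2 / 2"
      by (simp add: dot_square_norm)
    then show "- norm (q - p) / 2 = (p - c) \<bullet> (q - p) / norm (q - p)"
      using q by (simp add: power2_eq_square)
  qed
  moreover have "((\<lambda>q. - norm (q - p) / 2) \<longlongrightarrow> - norm (p - p) / 2) (at p within sphere c r)"
    by (intro tendsto_intros) auto
  ultimately show "((\<lambda>q. (p - c) \<bullet> (q - p) / norm (q - p)) \<longlongrightarrow> 0) (at p within sphere c r)"
    by (auto elim: Lim_transform_eventually)
qed

text \<open>
  If \<open>n\<close> had a component \<open>w\<close> orthogonal to the radius \<open>u\<close>, then along the great circle through \<open>p\<close> in direction
  \<open>w\<close> the defining quotient would tend to \<open>norm w\<close> instead of \<open>0\<close>.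
\<close>

lemma orthogonal_to_sphere_parallel:
  fixes c p n :: "'b::euclidean_space"
  assumes "dist c p = r" "r > 0" and orth: "orthogonal_to_hypersurface (sphere c r) p n"
  obtains k where "k \<noteq> 0" "n = k *\<^sub>R (p - c)"
proof -
  define u where "u = p - c"
  have u: "norm u = r" using assms by (simp add: u_def dist_norm norm_minus_commute)
  define k where "k = (n \<bullet> u) / r\<^sup>2"
  define w where "w = n - k *\<^sub>R u"
  have uu: "u \<bullet> u = r\<^sup>2" using u by (simp add: dot_square_norm)
  have wu: "w \<bullet> u = 0" using assms(2) by (simp add: w_def inner_diff_left uu k_def)
  have "w = 0"
  proof (rule ccontr)
    assume "w \<noteq> 0"
    define v where "v = (r / norm w) *\<^sub>R w"
    have vv: "v \<bullet> v = r\<^sup>2" "u \<bullet> v = 0"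
      using \<open>w \<noteq> 0\<close> wu by (simp_all add: v_def dot_square_norm inner_commute power2_eq_square)
    have nu: "n \<bullet> u = k * r\<^sup>2" using assms(2) by (simp add: k_def)
    have nv: "n \<bullet> v = r * norm w"
    proof -
      have "n \<bullet> v = (w + k *\<^sub>R u) \<bullet> v" by (simp add: w_def)
      also have "\<dots> = w \<bullet> v" by (simp add: inner_add_left vv)
      also have "\<dots> = r * norm w" using \<open>w \<noteq> 0\<close> by (simp add: v_def dot_square_norm power2_eq_square)
      finally show ?thesis .
    qed
    define q where "q = (\<lambda>t. c + cos t *\<^sub>R u + sin t *\<^sub>R v)"
    have qp: "q t - p = (cos t - 1) *\<^sub>R u + sin t *\<^sub>R v" for t
      by (simp add: q_def u_def algebra_simps)
    have "(norm (q t - c))\<^sup>2 = r\<^sup>2" for t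
    proof -
      have "(norm (q t - c))\<^sup>2 = (cos t)\<^sup>2 * r\<^sup>2 + (sin t)\<^sup>2 * r\<^sup>2"
        unfolding power2_norm_eq_inner by (simp add: q_def inner_add_left inner_add_right vv uu inner_commute[of v u] power2_eq_square)
      also have "\<dots> = ((cos t)\<^sup>2 + (sin t)\<^sup>2) * r\<^sup>2" by (simp only: distrib_right)
      finally show ?thesis by simp
    qed
    then have on_sphere: "q t \<in> sphere c r" for t
      using assms(2) by (simp add: dist_norm norm_minus_commute power2_eq_iff_nonneg)
    have nqp: "norm (q t - p) = r * sqrt (2 - 2 * cos t)" for t
    proof -
      have "(norm (q t - p))\<^sup>2 = (cos t - 1)\<^sup>2 * r\<^sup>2 + (sin t)\<^sup>2 * r\<^sup>2"
        unfolding power2_norm_eq_inner by (simp add: qp inner_add_left inner_add_right vv uu inner_commute[of v u] power2_eq_square)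
      also have "\<dots> = r\<^sup>2 * (((cos t)\<^sup>2 + (sin t)\<^sup>2) + 1 - 2 * cos t)"
        by (simp only: power2_diff) (simp add: algebra_simps del: sin_cos_squared_add sin_cos_squared_add2)
      also have "\<dots> = (r * sqrt (2 - 2 * cos t))\<^sup>2" by (simp add: power_mult_distrib)
      finally show ?thesis using assms(2) by (simp add: power2_eq_iff_nonneg)
    qed
    have "((\<lambda>q. n \<bullet> (q - p) / norm (q - p)) \<longlongrightarrow> 0) (at p within sphere c r)"
      using orth by (simp add: orthogonal_to_hypersurface_def)
    moreover have "filterlim q (at p within sphere c r) (at_right 0)"
      unfolding filterlim_at
    proof
      have "cos t \<noteq> 1" if "t \<in> {0<..<pi}" for t :: real
        using cos_monotone_0_pi[of 0 t] that by simp
      then have "\<forall>\<^sub>F t in at_right 0. cos t \<noteq> (1::real)"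
        by (intro eventually_at_rightI[of 0 pi]) auto
      then show "\<forall>\<^sub>F t in at_right 0. q t \<in> sphere c r \<and> q t \<noteq> p"
      proof eventually_elim
        case (elim t)
        then have "norm (q t - p) \<noteq> 0" using assms(2) unfolding nqp by simp
        then show ?case using on_sphere by auto
      qed
      have "(q \<longlongrightarrow> c + cos 0 *\<^sub>R u + sin 0 *\<^sub>R v) (at_right 0)"
        unfolding q_def by (intro tendsto_intros)
      then show "(q \<longlongrightarrow> p) (at_right 0)" by (simp add: u_def)
    qed
    ultimately have lim0: "((\<lambda>t. n \<bullet> (q t - p) / norm (q t - p)) \<longlongrightarrow> 0) (at_right 0)"
      by (rule filterlim_compose)
    have eq: "(\<lambda>t. n \<bullet> (q t - p) / norm (q t - p)) =
       (\<lambda>t. k * r * ((cos t - 1) / sqrt (2 - 2 * cos t)) + norm w * (sin t / sqrt (2 - 2 * cos t)))"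
    proof
      fix t
      show "n \<bullet> (q t - p) / norm (q t - p) = k * r * ((cos t - 1) / sqrt (2 - 2 * cos t)) + norm w * (sin t / sqrt (2 - 2 * cos t))"
        unfolding nqp using assms(2)
        by (simp add: qp inner_add_right nu nv power2_eq_square add_divide_distrib mult_ac)
    qed
    have lim1: "((\<lambda>t. k * r * ((cos t - 1) / sqrt (2 - 2 * cos t)) + norm w * (sin t / sqrt (2 - 2 * cos t))) \<longlongrightarrow> k * r * 0 + norm w * 1) (at_right 0)"
    proof (intro tendsto_intros)
      show "((\<lambda>t::real. (cos t - 1) / sqrt (2 - 2 * cos t)) \<longlongrightarrow> 0) (at_right 0)" by real_asymp
      show "((\<lambda>t::real. sin t / sqrt (2 - 2 * cos t)) \<longlongrightarrow> 1) (at_right 0)" by real_asymp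
    qed
    have "k * r * 0 + norm w * 1 = 0"
      by (rule tendsto_unique[OF trivial_limit_at_right_real lim1 lim0[unfolded eq]])
    then show False using \<open>w \<noteq> 0\<close> by simp
  qed
  then have "n = k *\<^sub>R (p - c)" by (simp add: w_def u_def)
  moreover have "k \<noteq> 0" using orth \<open>n = _\<close> by (auto simp: orthogonal_to_hypersurface_def)
  ultimately show ?thesis using that by blast
qed

text \<open>
  The normals at \<open>p\<close> are the multiples of \<open>p - (x, 0)\<close>, a vector of length \<open>r\<close> with vertical component \<open>h\<close>. All of
  them give the same angle, so the definite description in \<open>cell_angle\<close> is well-defined.
\<close>

lemma cell_angle_of_local_sphere:
  fixes x0 x :: "'a::euclidean_space"
  assumes U: "open U" "p \<in> U" "frontier (cell \<phi>) \<inter> U = sphere (x, 0) r \<inter> U"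
    and p: "p = (x0, cell_height \<phi> x0)" "dist (x, 0) p = r" "cell_height \<phi> x0 = h" "h > 0"
  shows "sin (cell_angle \<phi> x0) = h / r"
proof -
  have r: "r > 0" "h \<le> r"
  proof -
    have "dist (snd (x, 0 :: real)) (snd p) \<le> dist (x, 0) p" by (rule dist_snd_le)
    then show "h \<le> r" using p by simp
    then show "r > 0" using p by simp
  qed
  have orth: "orthogonal_to_hypersurface (frontier (cell \<phi>)) p n \<longleftrightarrow> orthogonal_to_hypersurface (sphere (x, 0) r) p n" for n
    by (rule orthogonal_to_hypersurface_local[OF U])
  have val: "\<bar>(k *\<^sub>R (p - (x, 0))) \<bullet> (0, 1)\<bar> / norm (k *\<^sub>R (p - (x, 0))) = h / r" if "k \<noteq> 0" for k
  proof -
    have "norm (p - (x, 0)) = r" using p(2) by (simp add: dist_norm norm_minus_commute)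
    then show ?thesis using that p(1,3,4) unfolding norm_scaleR inner_scaleR_left by (simp add: abs_mult)
  qed
  have "cell_angle \<phi> x0 = pi / 2 - arccos (h / r)"
    unfolding cell_angle_def
  proof (rule the_equality)
    show "\<exists>n. orthogonal_to_hypersurface (frontier (cell \<phi>)) (x0, cell_height \<phi> x0) n \<and>
      pi / 2 - arccos (h / r) = pi / 2 - arccos (\<bar>n \<bullet> (0, 1)\<bar> / norm n)"
      using orthogonal_to_sphere_radius[OF p(2) r(1)] val[of 1] orth p(1) by (intro exI[of _ "p - (x, 0)"]) simp
    fix \<psi> assume "\<exists>n. orthogonal_to_hypersurface (frontier (cell \<phi>)) (x0, cell_height \<phi> x0) n \<and>
      \<psi> = pi / 2 - arccos (\<bar>n \<bullet> (0, 1)\<bar> / norm n)"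
    then obtain n where n: "orthogonal_to_hypersurface (sphere (x, 0) r) p n" "\<psi> = pi / 2 - arccos (\<bar>n \<bullet> (0, 1)\<bar> / norm n)"
      using orth p(1) by auto
    from orthogonal_to_sphere_parallel[OF p(2) r(1) n(1)] obtain k where "k \<noteq> 0" "n = k *\<^sub>R (p - (x, 0))" by blast
    then show "\<psi> = pi / 2 - arccos (h / r)" using val n(2) by simp
  qed
  moreover have "0 \<le> h / r" "h / r \<le> 1" using r p(4) by auto
  ultimately show ?thesis by (simp add: sin_diff cos_arccos)
qed

text \<open>
  Let \<open>p\<close> be the top of the highest cap above \<open>x\<^sub>0\<close>. All other balls stay at positive distance from \<open>p\<close>, and only
  finitely many of them come within distance \<open>h / 2\<close> of it. Hence some ball around \<open>p\<close> meets none of the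
  others, and there the boundary of the cell is the sphere of the highest cap.
\<close>

lemma height_and_angle_of_highest_cap:
  fixes x0 :: "'a::euclidean_space"
  assumes \<phi>: "\<phi> \<subseteq> upper_half_space" and fin: "\<And>e. e > 0 \<Longrightarrow> finite (\<phi> \<inter> wide_cone x0 e)"
    and z: "z \<in> \<phi>" "norm (fst z - x0) < snd z"
    and highest: "\<And>z'. z' \<in> \<phi> \<Longrightarrow> z' \<noteq> z \<Longrightarrow> norm (fst z' - x0) < snd z' \<Longrightarrow> cap_level x0 z < cap_level x0 z'"
  shows "1 / cell_height \<phi> x0 ^ DIM('a) = cap_level x0 z" "cell_height \<phi> x0 > 0"
    "(sin (cell_angle \<phi> x0))\<^sup>2 = cap_slope x0 z"
proof -
  define h where "h = cap_height x0 z"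
  obtain x r where xr: "z = (x, r)" by (cases z)
  have r: "norm (x - x0) < r" "r > 0" using z(2) xr norm_ge_zero[of "x - x0"] by (simp_all del: norm_ge_zero)
  have h2: "h\<^sup>2 = r\<^sup>2 - (norm (x - x0))\<^sup>2" "h > 0"
  proof -
    have "(norm (x - x0))\<^sup>2 < r\<^sup>2" using r by (intro power_strict_mono) auto
    then show "h\<^sup>2 = r\<^sup>2 - (norm (x - x0))\<^sup>2" "h > 0" by (simp_all add: h_def cap_height_def xr)
  qed
  have distp: "dist (y, 0) (x0, t) = sqrt ((norm (y - x0))\<^sup>2 + t\<^sup>2)" for y and t :: real
    by (simp add: dist_norm norm_Pair)
  have lower: "\<rho> < dist (y, 0) (x0, h)" if "(y, \<rho>) \<in> \<phi>" "(y, \<rho>) \<noteq> z" for y \<rho>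
  proof -
    have "\<rho> > 0" using that(1) \<phi> by (auto simp: upper_half_space_def)
    have "\<rho>\<^sup>2 < (norm (y - x0))\<^sup>2 + h\<^sup>2"
    proof (cases "norm (y - x0) < \<rho>")
      case True
      define h' where "h' = cap_height x0 (y, \<rho>)"
      have "(norm (y - x0))\<^sup>2 < \<rho>\<^sup>2" using True by (intro power_strict_mono) auto
      then have h': "h'\<^sup>2 = \<rho>\<^sup>2 - (norm (y - x0))\<^sup>2" "h' > 0" by (simp_all add: h'_def cap_height_def)
      have "1 / h ^ DIM('a) < 1 / h' ^ DIM('a)"
        using highest[OF that] True by (simp add: cap_level_def h_def h'_def)
      then have "h' ^ DIM('a) < h ^ DIM('a)" using h' h2 by (simp add: field_simps)
      then have "h' < h" using h2 by (intro power_less_imp_less_base[of h' _ h]) auto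
      then have "h'\<^sup>2 < h\<^sup>2" using h' by (intro power_strict_mono) auto
      then show ?thesis using h' by simp
    next
      case False
      then have "\<rho>\<^sup>2 \<le> (norm (y - x0))\<^sup>2" using \<open>\<rho> > 0\<close> by (intro power_mono) auto
      moreover have "0 < h\<^sup>2" by (rule zero_less_power[OF h2(2)])
      ultimately show ?thesis by linarith
    qed
    then show ?thesis unfolding distp using \<open>\<rho> > 0\<close> by (simp add: real_less_rsqrt)
  qed
  have dz: "dist (x, 0) (x0, h) = r" unfolding distp using h2 r by simp
  have height: "cell_height \<phi> x0 = h"
  proof -
    have "{t. (x0, t) \<in> cell \<phi>} = {h..}"
    proof (intro equalityI subsetI)
      fix t assume "t \<in> {t. (x0, t) \<in> cell \<phi>}"
      then have t: "t > 0" "(x0, t) \<notin> ball (x, 0) r"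
        using z(1) xr by (auto simp: cell_def upper_half_space_def)
      then have "r \<le> sqrt ((norm (x - x0))\<^sup>2 + t\<^sup>2)" by (simp add: distp)
      then have "r\<^sup>2 \<le> (norm (x - x0))\<^sup>2 + t\<^sup>2" using r
        by (metis real_sqrt_le_iff real_sqrt_abs abs_of_pos)
      then have "h\<^sup>2 \<le> t\<^sup>2" using h2 by simp
      then show "t \<in> {h..}" using t by (simp add: power2_le_iff_abs_le)
    next
      fix t assume t: "t \<in> {h..}"
      have "(x0, t) \<notin> ball (y, 0) \<rho>" if "(y, \<rho>) \<in> \<phi>" for y \<rho>
      proof -
        have "\<rho> \<le> dist (y, 0) (x0, h)" using lower[OF that] dz xr by fastforce
        also have "\<dots> \<le> dist (y, 0) (x0, t)"
          unfolding distp using t h2 by (intro real_sqrt_le_mono add_left_mono power_mono) auto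
        finally show ?thesis by simp
      qed
      then show "t \<in> {t. (x0, t) \<in> cell \<phi>}" using t h2 by (auto simp: cell_def upper_half_space_def)
    qed
    then show ?thesis by (simp add: cell_height_def)
  qed
  then show "cell_height \<phi> x0 > 0" "1 / cell_height \<phi> x0 ^ DIM('a) = cap_level x0 z"
    using h2 by (simp_all add: cap_level_def h_def)
  define p where "p = (x0, h)"
  have finF: "finite (\<phi> \<inter> wide_cone x0 (h / 2) - {z})" using fin[of "h/2"] h2 by simp
  obtain \<epsilon> where \<epsilon>: "\<epsilon> > 0" "\<epsilon> \<le> h / 2" "\<And>y \<rho>. (y, \<rho>) \<in> \<phi> \<inter> wide_cone x0 (h / 2) - {z} \<Longrightarrow> \<epsilon> \<le> dist (y, 0) p - \<rho>"
  proof -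
    \<comment> \<open>Including \<open>h / 2\<close> keeps the neighbourhood above the boundary of the half-space and bounds the balls that can meet it to \<open>wide_cone\<close>.\<close>
    let ?E = "insert (h / 2) ((\<lambda>(y, \<rho>). dist (y, 0) p - \<rho>) ` (\<phi> \<inter> wide_cone x0 (h / 2) - {z}))"
    have "finite ?E" using finF by blast
    moreover have "\<forall>e\<in>?E. 0 < e" using lower h2(2) by (force simp: p_def)
    ultimately have "0 < Min ?E" by (subst Min_gr_iff) auto
    moreover have "Min ?E \<le> h / 2" by (rule Min_le[OF \<open>finite ?E\<close>]) simp
    moreover have "Min ?E \<le> dist (y, 0) p - \<rho>" if "(y, \<rho>) \<in> \<phi> \<inter> wide_cone x0 (h / 2) - {z}" for y \<rho>
      using that by (intro Min_le[OF \<open>finite ?E\<close>] insertI2 rev_image_eqI[OF that]) simp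
    ultimately show ?thesis by (rule that)
  qed
  define U where "U = ball p \<epsilon>"
  have cellU: "cell \<phi> \<inter> U = (- ball (x, 0) r) \<inter> U"
  proof (intro equalityI subsetI)
    fix q assume "q \<in> cell \<phi> \<inter> U"
    then show "q \<in> (- ball (x, 0) r) \<inter> U" using z(1) xr by (auto simp: cell_def)
  next
    fix q assume q: "q \<in> (- ball (x, 0) r) \<inter> U"
    then have qp: "dist p q < \<epsilon>" by (simp add: U_def)
    have "dist (snd p) (snd q) \<le> dist p q" by (rule dist_snd_le)
    then have "snd q > 0" using qp \<epsilon>(2) h2 by (simp add: p_def dist_real_def)
    moreover have "q \<notin> ball (y, 0) \<rho>" if y: "(y, \<rho>) \<in> \<phi>" for y \<rho>
    proof (cases "(y, \<rho>) = z")
      case True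
      then show ?thesis using q xr by simp
    next
      case False
      show ?thesis
      proof
        assume "q \<in> ball (y, 0) \<rho>"
        then have "dist (y, 0) p < \<rho> + \<epsilon>"
          using dist_triangle[of "(y, 0)" p q] qp by (simp add: dist_commute)
        have "dist (snd (y, 0::real)) (snd p) \<le> dist (y, 0) p" by (rule dist_snd_le)
        then have d1: "h \<le> dist (y, 0) p" using h2 by (simp add: p_def)
        have "dist (fst (y, 0::real)) (fst p) \<le> dist (y, 0) p" by (rule dist_fst_le)
        then have d2: "norm (y - x0) \<le> dist (y, 0) p" by (simp add: p_def dist_norm)
        have "(y, \<rho>) \<in> wide_cone x0 (h / 2)"
          using d1 d2 \<open>dist (y, 0) p < \<rho> + \<epsilon>\<close> \<epsilon>(2) by (simp add: wide_cone_def)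
        then have "\<epsilon> \<le> dist (y, 0) p - \<rho>" using \<epsilon>(3) y False by blast
        then show False using \<open>dist (y, 0) p < \<rho> + \<epsilon>\<close> by simp
      qed
    qed
    ultimately show "q \<in> cell \<phi> \<inter> U" using q by (cases q) (auto simp: cell_def upper_half_space_def)
  qed
  have "frontier (cell \<phi>) \<inter> U = frontier (- ball (x, 0) r) \<inter> U"
    using cellU by (intro frontier_local) (simp_all add: U_def)
  also have "frontier (- ball (x, 0 :: real) r) = sphere (x, 0) r"
    using r by (simp add: frontier_complement)
  finally have "sin (cell_angle \<phi> x0) = h / r"
    using \<epsilon>(1) height h2 dz by (intro cell_angle_of_local_sphere[of U p]) (simp_all add: U_def p_def)
  then show "(sin (cell_angle \<phi> x0))\<^sup>2 = cap_slope x0 z"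
    using r h2 by (simp add: cap_slope_def xr power_divide diff_divide_distrib)
qed

section \<open>Events of the process of caps\<close>

lemma space_config_space [simp]: "space (config_space S) = locally_finite_sets S"
  by (auto simp: config_space_def intro!: space_measure_of)

lemma measurable_num_points [measurable]:
  assumes "A \<in> sets borel"
  shows "num_points A \<in> config_space S \<rightarrow>\<^sub>M borel"
proof (rule measurableI)
  fix B :: "ennreal set" assume "B \<in> sets borel"
  then show "num_points A -` B \<inter> space (config_space S) \<in> sets (config_space S)"
    using assms unfolding space_config_space by (auto simp: config_space_def intro!: in_measure_of)
qed auto

lemma num_points_eq_0_iff: "num_points A \<phi> = 0 \<longleftrightarrow> \<phi> \<inter> A = {}"
  unfolding num_points_def by (subst emeasure_count_space_eq_0) auto

lemma num_points_eq_1_iff: "num_points A \<phi> = 1 \<longleftrightarrow> (\<exists>z. \<phi> \<inter> A = {z})"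
proof -
  have "num_points A \<phi> = 1 \<longleftrightarrow> finite (\<phi> \<inter> A) \<and> card (\<phi> \<inter> A) = 1"
    unfolding num_points_def by (cases "finite (\<phi> \<inter> A)") (auto simp: emeasure_count_space)
  also have "\<dots> \<longleftrightarrow> (\<exists>z. \<phi> \<inter> A = {z})"
    by (auto simp: card_1_singleton_iff)
  finally show ?thesis .
qed

lemma finite_iff_num_points: "finite (\<phi> \<inter> A) \<longleftrightarrow> num_points A \<phi> \<noteq> \<infinity>"
  unfolding num_points_def by (auto simp: emeasure_count_space)

text \<open>
  There is no cap of level at most \<open>a\<close>, and exactly one with level in \<open>(a, b]\<close>, whose slope is in \<open>C\<close>. The three
  conditions concern disjoint sets of points, so they are independent.
\<close>

definition first_cap :: "'a::euclidean_space \<Rightarrow> real \<Rightarrow> real \<Rightarrow> real set \<Rightarrow> ('a \<times> real) set set" where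
  "first_cap x0 a b C = {\<phi> \<in> locally_finite_sets upper_half_space.
     num_points (strip x0 0 a UNIV) \<phi> = 0 \<and> num_points (strip x0 a b C) \<phi> = 1 \<and>
     num_points (strip x0 a b (- C)) \<phi> = 0}"

definition first_cap_grid :: "'a::euclidean_space \<Rightarrow> real \<Rightarrow> real set \<Rightarrow> nat \<Rightarrow> ('a \<times> real) set set" where
  "first_cap_grid x0 a C m =
     (\<Union>i. first_cap x0 (a + real i / real (Suc m)) (a + real (Suc i) / real (Suc m)) C)"

text \<open>
  The events \<open>first_cap\<close> over all intervals of all grids of mesh \<open>1 / (m + 1)\<close> that start at \<open>a \<ge> 0\<close>. For a configuration in
  this set there is a unique highest cap, its level exceeds \<open>a\<close> and its slope is in \<open>C\<close>.
\<close>

definition leader :: "'a::euclidean_space \<Rightarrow> real \<Rightarrow> real set \<Rightarrow> ('a \<times> real) set set" where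
  "leader x0 a C = (\<Union>m. first_cap_grid x0 a C m)"

text \<open>
  As \<open>wide_cone x0 e\<close> grows when \<open>e\<close> decreases, the countably many values \<open>1 / (m + 1)\<close> cover all \<open>e > 0\<close>, and
  countably many conditions can hold almost surely together.
\<close>

definition tame :: "'a::euclidean_space \<Rightarrow> ('a \<times> real) set set" where
  "tame x0 = {\<phi> \<in> locally_finite_sets upper_half_space.
     \<forall>m. num_points (wide_cone x0 (1 / real (Suc m))) \<phi> \<noteq> \<infinity>}"

text \<open>
  For \<open>a \<ge> 0\<close>, the two events between which the event \<open>1 / \<H> ^ n > a\<close>, \<open>(sin \<Theta>)\<^sup>2 \<in> C\<close> is squeezed:
  \<open>inner_event\<close> implies it and
  \<open>complement_event\<close> excludes it. Both are measurable on configurations and do not involve the intensity.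
\<close>

definition inner_event :: "'a::euclidean_space \<Rightarrow> real \<Rightarrow> real set \<Rightarrow> ('a \<times> real) set set" where
  "inner_event x0 a C = leader x0 a C \<inter> tame x0"

definition hit :: "'a::euclidean_space \<Rightarrow> real \<Rightarrow> ('a \<times> real) set set" where
  "hit x0 a = {\<phi> \<in> locally_finite_sets upper_half_space. num_points (strip x0 0 a UNIV) \<phi> \<noteq> 0}"

definition complement_event :: "'a::euclidean_space \<Rightarrow> real \<Rightarrow> real set \<Rightarrow> ('a \<times> real) set set" where
  "complement_event x0 a C = (leader x0 a (- C) \<union> (leader x0 0 UNIV \<inter> hit x0 a)) \<inter> tame x0"

lemma sets_events [measurable]:
  assumes [measurable]: "C \<in> sets borel"
  shows "first_cap x0 a b C \<in> sets (config_space upper_half_space)"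
    "first_cap_grid x0 a C m \<in> sets (config_space upper_half_space)"
    "leader x0 a C \<in> sets (config_space upper_half_space)"
    "tame x0 \<in> sets (config_space upper_half_space)"
    "hit x0 a \<in> sets (config_space upper_half_space)"
    "inner_event x0 a C \<in> sets (config_space upper_half_space)"
    "complement_event x0 a C \<in> sets (config_space upper_half_space)"
proof -
  have C: "- C \<in> sets borel" using assms by simp
  have 1: "first_cap x0 a b C \<in> sets (config_space upper_half_space)" if "C \<in> sets borel" for a b C
  proof -
    have [measurable]: "C \<in> sets borel" "- C \<in> sets borel" using that by auto
    show ?thesis unfolding first_cap_def space_config_space[symmetric] by measurable
  qed
  then have 2: "first_cap_grid x0 a C m \<in> sets (config_space upper_half_space)" if "C \<in> sets borel" for a C m
    unfolding first_cap_grid_def using that by auto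
  then have 3: "leader x0 a C \<in> sets (config_space upper_half_space)" if "C \<in> sets borel" for a C
    unfolding leader_def using that by auto
  have 4: "tame x0 \<in> sets (config_space upper_half_space)"
    unfolding tame_def space_config_space[symmetric] by measurable
  have 5: "hit x0 a \<in> sets (config_space upper_half_space)" for a
    unfolding hit_def space_config_space[symmetric] by measurable
  show "first_cap x0 a b C \<in> sets (config_space upper_half_space)"
    "first_cap_grid x0 a C m \<in> sets (config_space upper_half_space)"
    "leader x0 a C \<in> sets (config_space upper_half_space)"
    "tame x0 \<in> sets (config_space upper_half_space)"
    "hit x0 a \<in> sets (config_space upper_half_space)"
    using 1 2 3 4 5 assms by auto
  show "inner_event x0 a C \<in> sets (config_space upper_half_space)"
    unfolding inner_event_def using 3[OF assms] 4 by (rule sets.Int)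
  show "complement_event x0 a C \<in> sets (config_space upper_half_space)"
    unfolding complement_event_def using 3[OF C] 3[of UNIV 0] 4 5 by (intro sets.Int sets.Un) auto
qed

lemma cap_level_pos: "norm (fst z - x0) < snd z \<Longrightarrow> cap_level x0 z > 0"
  using power_strict_mono[of "norm (fst z - x0)" "snd z" 2] by (simp add: cap_level_def cap_height_def)

lemma first_capE:
  assumes "\<phi> \<in> first_cap x0 a b C" "0 \<le> a"
  obtains z where "z \<in> \<phi>" "norm (fst z - x0) < snd z" "a < cap_level x0 z" "cap_level x0 z \<le> b" "cap_slope x0 z \<in> C"
    "\<And>z'. z' \<in> \<phi> \<Longrightarrow> z' \<noteq> z \<Longrightarrow> norm (fst z' - x0) < snd z' \<Longrightarrow> cap_level x0 z < cap_level x0 z'"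
proof -
  have e: "\<phi> \<inter> strip x0 0 a UNIV = {}" "\<phi> \<inter> strip x0 a b (- C) = {}" and "\<exists>z. \<phi> \<inter> strip x0 a b C = {z}"
    using assms(1) by (simp_all add: first_cap_def num_points_eq_0_iff num_points_eq_1_iff)
  then obtain z where z: "\<phi> \<inter> strip x0 a b C = {z}" by blast
  have zs: "z \<in> \<phi>" "z \<in> strip x0 a b C" using z by auto
  have "cap_level x0 z < cap_level x0 z'" if z': "z' \<in> \<phi>" "z' \<noteq> z" "norm (fst z' - x0) < snd z'" for z'
  proof -
    have "\<not> cap_level x0 z' \<le> a"
      using e(1) z' cap_level_pos[OF z'(3)] by (auto simp: strip_def)
    moreover have "z' \<notin> strip x0 a b C" "z' \<notin> strip x0 a b (- C)" using z z' e(2) by auto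
    ultimately have "b < cap_level x0 z'" using z' by (auto simp: strip_def)
    then show ?thesis using zs by (simp add: strip_def)
  qed
  with zs show ?thesis by (intro that[of z]) (auto simp: strip_def)
qed

lemma first_cap_not_hit:
  assumes "\<phi> \<in> first_cap x0 a' b C" "a \<le> a'"
  shows "\<phi> \<notin> hit x0 a"
proof -
  have "\<phi> \<inter> strip x0 0 a' UNIV = {}" using assms by (simp add: first_cap_def num_points_eq_0_iff)
  moreover have "strip x0 0 a UNIV \<subseteq> strip x0 0 a' UNIV" using assms(2) by (auto simp: strip_def)
  ultimately show ?thesis by (auto simp: hit_def num_points_eq_0_iff)
qed

lemma leaderE:
  assumes "\<phi> \<in> leader x0 a C" "0 \<le> a"
  obtains z where "z \<in> \<phi>" "norm (fst z - x0) < snd z" "a < cap_level x0 z" "cap_slope x0 z \<in> C"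
    "\<And>z'. z' \<in> \<phi> \<Longrightarrow> z' \<noteq> z \<Longrightarrow> norm (fst z' - x0) < snd z' \<Longrightarrow> cap_level x0 z < cap_level x0 z'"
proof -
  from assms(1) obtain m i where "\<phi> \<in> first_cap x0 (a + real i / real (Suc m)) (a + real (Suc i) / real (Suc m)) C"
    by (auto simp: leader_def first_cap_grid_def simp del: of_nat_Suc)
  then show ?thesis
  proof (rule first_capE)
    fix z assume z: "z \<in> \<phi>" "norm (fst z - x0) < snd z" "a + real i / real (Suc m) < cap_level x0 z" "cap_slope x0 z \<in> C"
      "\<And>z'. z' \<in> \<phi> \<Longrightarrow> z' \<noteq> z \<Longrightarrow> norm (fst z' - x0) < snd z' \<Longrightarrow> cap_level x0 z < cap_level x0 z'"
    moreover have "a < cap_level x0 z"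
      using z(3) by (rule le_less_trans[rotated]) simp
    ultimately show ?thesis by (intro that[of z])
  qed (use assms(2) in simp)
qed

lemma leader_not_hit:
  assumes "\<phi> \<in> leader x0 a C"
  shows "\<phi> \<notin> hit x0 a"
proof -
  from assms obtain m i where "\<phi> \<in> first_cap x0 (a + real i / real (Suc m)) (a + real (Suc i) / real (Suc m)) C"
    by (auto simp: leader_def first_cap_grid_def simp del: of_nat_Suc)
  then show ?thesis by (rule first_cap_not_hit) simp
qed

lemma height_and_angle_of_leader:
  fixes x0 :: "'a::euclidean_space"
  assumes \<phi>: "\<phi> \<in> leader x0 a C" "\<phi> \<in> tame x0" and a: "0 \<le> a"
  shows "cell_height \<phi> x0 > 0" "a < 1 / cell_height \<phi> x0 ^ DIM('a)" "(sin (cell_angle \<phi> x0))\<^sup>2 \<in> C"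
    "\<And>b. \<phi> \<in> hit x0 b \<Longrightarrow> 1 / cell_height \<phi> x0 ^ DIM('a) \<le> b"
proof -
  have sub: "\<phi> \<subseteq> upper_half_space" using \<phi>(2) by (simp add: tame_def locally_finite_sets_def)
  have fin: "finite (\<phi> \<inter> wide_cone x0 e)" if "e > 0" for e
  proof -
    from reals_Archimedean[OF that] obtain m where "1 / real (Suc m) < e" by (auto simp: field_simps)
    then have "\<phi> \<inter> wide_cone x0 e \<subseteq> \<phi> \<inter> wide_cone x0 (1 / real (Suc m))"
      by (auto simp: wide_cone_def)
    moreover have "finite (\<phi> \<inter> wide_cone x0 (1 / real (Suc m)))"
      using \<phi>(2) unfolding finite_iff_num_points tame_def by blast
    ultimately show ?thesis by (rule finite_subset)
  qed
  from leaderE[OF \<phi>(1) a] obtain z where z: "z \<in> \<phi>" "norm (fst z - x0) < snd z" "a < cap_level x0 z" "cap_slope x0 z \<in> C"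
    "\<And>z'. z' \<in> \<phi> \<Longrightarrow> z' \<noteq> z \<Longrightarrow> norm (fst z' - x0) < snd z' \<Longrightarrow> cap_level x0 z < cap_level x0 z'"
    by blast
  note H = height_and_angle_of_highest_cap[OF sub fin z(1,2,5)]
  show "cell_height \<phi> x0 > 0" "a < 1 / cell_height \<phi> x0 ^ DIM('a)" "(sin (cell_angle \<phi> x0))\<^sup>2 \<in> C"
    using H z by auto
  fix b assume "\<phi> \<in> hit x0 b"
  then obtain z' where z': "z' \<in> \<phi>" "norm (fst z' - x0) < snd z'" "cap_level x0 z' \<le> b"
    by (auto simp: hit_def num_points_eq_0_iff strip_def)
  have "cap_level x0 z \<le> cap_level x0 z'" using z(5)[of z'] z' by (cases "z' = z") auto
  then show "1 / cell_height \<phi> x0 ^ DIM('a) \<le> b" using z'(3) H(1) by simp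
qed

lemma height_and_angle_inner_event:
  fixes x0 :: "'a::euclidean_space"
  assumes "\<phi> \<in> inner_event x0 a C" "0 \<le> a"
  shows "cell_height \<phi> x0 > 0" "a < 1 / cell_height \<phi> x0 ^ DIM('a)" "(sin (cell_angle \<phi> x0))\<^sup>2 \<in> C"
  using height_and_angle_of_leader[of \<phi> x0 a C] assms by (auto simp: inner_event_def)

lemma height_and_angle_complement_event:
  fixes x0 :: "'a::euclidean_space"
  assumes "\<phi> \<in> complement_event x0 a C" "0 \<le> a"
  shows "cell_height \<phi> x0 > 0" "\<not> (a < 1 / cell_height \<phi> x0 ^ DIM('a) \<and> (sin (cell_angle \<phi> x0))\<^sup>2 \<in> C)"
proof -
  have "cell_height \<phi> x0 > 0 \<and> \<not> (a < 1 / cell_height \<phi> x0 ^ DIM('a) \<and> (sin (cell_angle \<phi> x0))\<^sup>2 \<in> C)"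
  proof (cases "\<phi> \<in> leader x0 a (- C)")
    case True
    then show ?thesis using height_and_angle_of_leader[of \<phi> x0 a "- C"] assms by (auto simp: complement_event_def)
  next
    case False
    then have "\<phi> \<in> leader x0 0 UNIV" "\<phi> \<in> hit x0 a" "\<phi> \<in> tame x0" using assms by (auto simp: complement_event_def)
    with height_and_angle_of_leader[of \<phi> x0 0 UNIV] show ?thesis by (auto simp: not_less)
  qed
  then show "cell_height \<phi> x0 > 0" "\<not> (a < 1 / cell_height \<phi> x0 ^ DIM('a) \<and> (sin (cell_angle \<phi> x0))\<^sup>2 \<in> C)"
    by auto
qed

locale cell_process =
  fixes P :: "('a::euclidean_space \<times> real) set measure" and s :: real and x0 :: 'a
  assumes s_pos: "s > 0"
    and poisson: "poisson_process_law upper_half_space (cell_intensity (Suc DIM('a)) s) P"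
begin

sublocale prob_space P
  using poisson by (simp add: poisson_process_law_def)

lemma space_P: "space P = locally_finite_sets upper_half_space"
  and sets_P [measurable_cong]: "sets P = sets (config_space upper_half_space)"
  using poisson by (auto simp: poisson_process_law_def)

abbreviation \<mu> :: "('a \<times> real) measure" where "\<mu> \<equiv> cell_intensity (Suc DIM('a)) s"

sublocale B: prob_space "beta_law (real DIM('a) / 2 + 1) (real DIM('a) / 2)"
  by (rule prob_space_beta_law) auto

lemma prob_num_points:
  assumes "A \<in> sets borel" "emeasure \<mu> A < \<infinity>"
  shows "prob {\<phi>\<in>space P. num_points A \<phi> = of_nat k} = measure \<mu> A ^ k / fact k * exp (- measure \<mu> A)"
  using poisson assms unfolding poisson_process_law_def by blast

lemma measure_strip:
  assumes "C \<in> sets borel" "0 \<le> a" "a \<le> b"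
  shows "emeasure \<mu> (strip x0 a b C) < \<infinity>" "measure \<mu> (strip x0 a b C) = s * (b - a) * B.prob C"
proof -
  have "emeasure \<mu> (strip x0 a b C) = ennreal (s * (b - a) * B.prob C)"
    using emeasure_strip[OF s_pos assms(2,3,1), of x0] assms s_pos
    by (simp add: B.emeasure_eq_measure ennreal_mult')
  then show "emeasure \<mu> (strip x0 a b C) < \<infinity>" "measure \<mu> (strip x0 a b C) = s * (b - a) * B.prob C"
    using assms s_pos by (simp_all add: measure_def)
qed

text \<open>
  The exponential factors of the three independent counts combine to the void probability of all
  caps of level at most \<open>b\<close>, so that only the factor for the single point depends on \<open>C\<close>.
\<close>

lemma prob_first_cap:
  assumes C: "C \<in> sets borel" and ab: "0 \<le> a" "a \<le> b"
  shows "prob (first_cap x0 a b C) = s * (b - a) * B.prob C * exp (- s * b)"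
proof -
  define A where "A i = (if i = 0 then strip x0 0 a UNIV else if i = 1 then strip x0 a b C else strip x0 a b (- C))" for i :: nat
  define v where "v i = (if i = 1 then 1 else 0 :: ennreal)" for i :: nat
  have C': "- C \<in> sets borel" using C by simp
  have three: "{..<3::nat} = {0, 1, 2}" by auto
  have "indep_vars (\<lambda>_. borel) (\<lambda>i. num_points (A i)) {..<3}"
  proof -
    have "(\<forall>i<3. A i \<in> sets borel) \<and> disjoint_family_on A {..<3}"
    proof
      show "\<forall>i<3. A i \<in> sets borel" using C C' by (auto simp: A_def strip_borel)
      show "disjoint_family_on A {..<3}"
        unfolding three by (auto simp: A_def disjoint_family_on_def strip_def)
    qed
    then show ?thesis using poisson unfolding poisson_process_law_def by blast
  qed
  then have "prob (\<Inter>i\<in>{..<3}. num_points (A i) -` {v i} \<inter> space P) = (\<Prod>i\<in>{..<3}. prob (num_points (A i) -` {v i} \<inter> space P))"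
    by (rule indep_varsD) (auto simp: lessThan_empty_iff)
  also have "(\<Inter>i\<in>{..<3}. num_points (A i) -` {v i} \<inter> space P) = first_cap x0 a b C"
    unfolding three by (auto simp: A_def v_def first_cap_def space_P)
  also have "(\<Prod>i\<in>{..<3}. prob (num_points (A i) -` {v i} \<inter> space P)) =
      prob {\<phi>\<in>space P. num_points (strip x0 0 a UNIV) \<phi> = of_nat 0} *
      (prob {\<phi>\<in>space P. num_points (strip x0 a b C) \<phi> = of_nat 1} *
       prob {\<phi>\<in>space P. num_points (strip x0 a b (- C)) \<phi> = of_nat 0})"
    unfolding three by (simp add: A_def v_def vimage_def Int_def conj_commute)
  also have "\<dots> = exp (- (s * a)) * (s * (b - a) * B.prob C * exp (- (s * (b - a) * B.prob C)) *
       exp (- (s * (b - a) * (1 - B.prob C))))"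
  proof -
    have "B.prob (- C) = 1 - B.prob C" using B.prob_compl[of C] C by (simp add: Compl_eq_Diff_UNIV)
    moreover have "B.prob UNIV = 1" using B.prob_space by simp
    ultimately show ?thesis
      using measure_strip[OF C ab] measure_strip[OF C' ab] measure_strip[of UNIV 0 a] ab C C'
      by (subst (1 2 3) prob_num_points) (auto simp: strip_borel)
  qed
  also have "\<dots> = s * (b - a) * B.prob C * exp (- s * b)"
  proof -
    have "- (s * a) + - (s * (b - a) * B.prob C) + - (s * (b - a) * (1 - B.prob C)) = - s * b"
      by (simp add: algebra_simps)
    then have exps: "exp (- (s * a)) * exp (- (s * (b - a) * B.prob C)) * exp (- (s * (b - a) * (1 - B.prob C))) = exp (- s * b)"
      by (simp only: exp_add[symmetric])
    show ?thesis by (subst exps[symmetric]) (simp only: mult_ac)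
  qed
  finally show ?thesis .
qed

text \<open>
  The events for different intervals of the grid are disjoint, and their probabilities form a geometric
  series.
\<close>

lemma prob_first_cap_grid:
  assumes C: "C \<in> sets borel" and a: "0 \<le> a"
  defines "x \<equiv> \<lambda>m. s / real (Suc m)"
  shows "prob (first_cap_grid x0 a C m) = exp (- s * a) * B.prob C * (x m * exp (- x m) / (1 - exp (- x m)))"
proof -
  define F where "F i = first_cap x0 (a + real i / real (Suc m)) (a + real (Suc i) / real (Suc m)) C" for i
  have m: "real (Suc m) > 0" by simp
  have F: "F i \<in> events" for i using C unfolding F_def sets_P by (rule sets_events)
  have "F i \<inter> F j = {}" if "i < j" for i j
  proof -
    have "a + real (Suc i) / real (Suc m) \<le> a + real j / real (Suc m)"
      using that by (intro add_left_mono divide_right_mono) auto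
    then have "\<phi> \<notin> hit x0 (a + real (Suc i) / real (Suc m))" if "\<phi> \<in> F j" for \<phi>
      using first_cap_not_hit that unfolding F_def by blast
    moreover have "\<phi> \<in> hit x0 (a + real (Suc i) / real (Suc m))" if \<phi>: "\<phi> \<in> F i" for \<phi>
    proof -
      have a': "0 \<le> a + real i / real (Suc m)" using a by simp
      have "\<phi> \<in> locally_finite_sets upper_half_space" using \<phi> by (simp add: F_def first_cap_def)
      moreover obtain z where "z \<in> \<phi>" "norm (fst z - x0) < snd z"
          "a + real i / real (Suc m) < cap_level x0 z" "cap_level x0 z \<le> a + real (Suc i) / real (Suc m)"
        using first_capE[OF \<phi>[unfolded F_def] a'] by blast
      moreover from this a' have "0 < cap_level x0 z" by linarith
      ultimately show ?thesis by (auto simp: hit_def num_points_eq_0_iff strip_def)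
    qed
    ultimately show ?thesis by blast
  qed
  then have "disjoint_family F"
    unfolding disjoint_family_on_def by (metis Int_commute linorder_neq_iff)
  then have "(\<lambda>i. prob (F i)) sums prob (\<Union>i. F i)"
    using F by (intro finite_measure_UNION) auto
  moreover have "(\<lambda>i. prob (F i)) sums (exp (- s * a) * B.prob C * (x m * exp (- x m)) * (1 / (1 - exp (- x m))))"
  proof -
    have xm: "x m > 0" unfolding x_def using s_pos by simp
    have "prob (F i) = exp (- s * a) * B.prob C * (x m * exp (- x m)) * exp (- x m) ^ i" for i
    proof -
      have "prob (F i) = s * ((a + real (Suc i) / real (Suc m)) - (a + real i / real (Suc m))) * B.prob C * exp (- s * (a + real (Suc i) / real (Suc m)))"
        unfolding F_def using a by (intro prob_first_cap[OF C]) (auto intro!: divide_right_mono)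
      also have "s * ((a + real (Suc i) / real (Suc m)) - (a + real i / real (Suc m))) = x m"
        using m unfolding x_def by (simp add: field_simps)
      also have "- s * (a + real (Suc i) / real (Suc m)) = - s * a + (- x m + real i * (- x m))"
      proof -
        have "- s * (a + real (Suc i) / D) = - s * a + (- (s / D) + real i * (- (s / D)))" if "D > 0" for D :: real
          using that by (simp add: field_simps)
        from this[OF m] show ?thesis unfolding x_def .
      qed
      finally show ?thesis by (simp only: exp_add exp_of_nat_mult mult_ac)
    qed
    moreover have "(\<lambda>i. exp (- x m) ^ i) sums (1 / (1 - exp (- x m)))"
      using xm by (intro geometric_sums) simp
    ultimately show ?thesis by (simp only: sums_mult)
  qed
  ultimately have "prob (\<Union>i. F i) = exp (- s * a) * B.prob C * (x m * exp (- x m)) * (1 / (1 - exp (- x m)))"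
    by (rule sums_unique2)
  then show ?thesis by (simp add: first_cap_grid_def F_def)
qed

text \<open>
  With \<open>x = s / (m + 1)\<close>, the probability for the grid of mesh \<open>1 / (m + 1)\<close> differs from the bound by the
  factor \<open>x * exp (- x) / (1 - exp (- x))\<close>, which accounts for intervals with several points and tends to \<open>1\<close>.
\<close>

lemma prob_leader_ge:
  assumes C: "C \<in> sets borel" and a: "0 \<le> a"
  shows "exp (- s * a) * B.prob C \<le> prob (leader x0 a C)"
proof -
  define x where "x m = s / real (Suc m)" for m
  have lim: "((\<lambda>t::real. t * exp (- t) / (1 - exp (- t))) \<longlongrightarrow> 1) (at_right 0)" by real_asymp
  have "filterlim x (at_right 0) sequentially"
    unfolding x_def filterlim_at
  proof
    show "(\<lambda>m. s / real (Suc m)) \<longlonglongrightarrow> 0" by real_asymp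
  qed (use s_pos in auto)
  from filterlim_compose[OF lim this]
  have "(\<lambda>m. exp (- s * a) * B.prob C * (x m * exp (- x m) / (1 - exp (- x m)))) \<longlonglongrightarrow> exp (- s * a) * B.prob C * 1"
    by (rule tendsto_mult_left)
  moreover have "exp (- s * a) * B.prob C * (x m * exp (- x m) / (1 - exp (- x m))) \<le> prob (leader x0 a C)" for m
    using prob_first_cap_grid[OF C a, of m] sets_events(3)[OF C, of x0 a]
    unfolding x_def[symmetric] leader_def sets_P[symmetric]
    by (metis UN_upper UNIV_I finite_measure_mono)
  ultimately show ?thesis using LIMSEQ_le_const2 by fastforce
qed

text \<open>
  The Poisson probabilities of the finite values sum to \<open>1\<close>, so the count over a set of finite
  intensity is almost surely finite.
\<close>

lemma AE_tame: "AE \<phi> in P. \<phi> \<in> tame x0"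
proof -
  have *: "AE \<phi> in P. num_points A \<phi> \<noteq> \<infinity>" if A: "A \<in> sets borel" "emeasure \<mu> A < \<infinity>" for A
  proof -
    define E where "E k = {\<phi>\<in>space P. num_points A \<phi> = of_nat k}" for k
    have E: "E k \<in> events" for k unfolding E_def using A(1) by measurable
    have "(\<lambda>k. prob (E k)) sums prob (\<Union>k. E k)"
      using E by (intro finite_measure_UNION) (auto simp: E_def disjoint_family_on_def)
    moreover have "(\<lambda>k. prob (E k)) sums (exp (measure \<mu> A) * exp (- measure \<mu> A))"
      unfolding E_def prob_num_points[OF A]
      using sums_mult2[OF exp_converges[of "measure \<mu> A"], of "exp (- measure \<mu> A)"]
      by (simp add: divide_inverse mult_ac)
    ultimately have "prob (\<Union>k. E k) = 1"
      using sums_unique2 by (metis exp_minus_inverse)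
    then have "AE \<phi> in P. \<phi> \<in> (\<Union>k. E k)" using E by (intro AE_in_set_eq_1[THEN iffD2]) auto
    then show ?thesis by eventually_elim (auto simp: E_def)
  qed
  have "AE \<phi> in P. \<forall>m. num_points (wide_cone x0 (1 / real (Suc m))) \<phi> \<noteq> \<infinity>"
    unfolding AE_all_countable
  proof
    fix m
    have "emeasure \<mu> (wide_cone x0 (1 / real (Suc m))) < \<infinity>"
      by (rule emeasure_wide_cone_finite[OF _ s_pos]) simp
    then show "AE \<phi> in P. num_points (wide_cone x0 (1 / real (Suc m))) \<phi> \<noteq> \<infinity>"
      by (rule *[OF wide_cone_borel])
  qed
  then show ?thesis using AE_space by eventually_elim (simp add: tame_def space_P)
qed

lemma prob_Int_tame:
  assumes "A \<in> events"
  shows "prob (A \<inter> tame x0) = prob A"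
proof (rule finite_measure_eq_AE)
  show "AE \<phi> in P. \<phi> \<in> A \<inter> tame x0 \<longleftrightarrow> \<phi> \<in> A"
    using AE_tame by eventually_elim auto
  show "A \<inter> tame x0 \<in> events"
    using assms sets_events(4)[of UNIV x0] by (auto simp: sets_P)
qed fact

lemma prob_inner_event_ge:
  assumes "C \<in> sets borel" "0 \<le> a"
  shows "exp (- s * a) * B.prob C \<le> prob (inner_event x0 a C)"
proof -
  have "leader x0 a C \<in> events" unfolding sets_P by (rule sets_events(3)[OF assms(1)])
  then show ?thesis using prob_leader_ge[OF assms] by (simp add: inner_event_def prob_Int_tame)
qed

lemma prob_hit:
  assumes "0 \<le> a"
  shows "prob (hit x0 a) = 1 - exp (- s * a)"
proof -
  have "prob {\<phi>\<in>space P. num_points (strip x0 0 a UNIV) \<phi> = of_nat 0} = exp (- s * a)"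
    using measure_strip[of UNIV 0 a] assms B.prob_space by (subst prob_num_points) (auto simp: strip_borel)
  moreover have "hit x0 a = space P - {\<phi>\<in>space P. num_points (strip x0 0 a UNIV) \<phi> = of_nat 0}"
    by (auto simp: hit_def space_P)
  moreover have "{\<phi>\<in>space P. num_points (strip x0 0 a UNIV) \<phi> = of_nat 0} \<in> events"
    using strip_borel[of UNIV x0 0 a] by measurable
  ultimately show ?thesis by (simp only: prob_compl)
qed

text \<open>
  The second part of \<open>complement_event\<close> needs a highest cap to exist. That has probability \<open>1\<close> by
  \<open>prob_leader_ge\<close> with \<open>a = 0\<close> and \<open>C = UNIV\<close>.
\<close>

lemma prob_complement_event_ge:
  assumes C: "C \<in> sets borel" and a: "0 \<le> a"
  shows "1 - exp (- s * a) * B.prob C \<le> prob (complement_event x0 a C)"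
proof -
  have C': "- C \<in> sets borel" using C by simp
  have ev: "leader x0 a (- C) \<in> events" "leader x0 0 UNIV \<in> events" "hit x0 a \<in> events"
    unfolding sets_P by (auto intro!: sets_events C' sets_events(5)[of UNIV])
  have "prob (leader x0 0 UNIV) = 1"
    using prob_leader_ge[of UNIV 0] B.prob_space
    by (intro antisym prob_le_1) simp
  then have "AE \<phi> in P. \<phi> \<in> leader x0 0 UNIV" using ev(2) by (intro AE_in_set_eq_1[THEN iffD2]) auto
  then have "prob (leader x0 0 UNIV \<inter> hit x0 a) = prob (hit x0 a)"
    using ev by (intro finite_measure_eq_AE) auto
  also have "\<dots> = 1 - exp (- s * a)" by (rule prob_hit[OF a])
  finally have 1: "prob (leader x0 0 UNIV \<inter> hit x0 a) = 1 - exp (- s * a)" .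
  have "B.prob (- C) = 1 - B.prob C" using B.prob_compl[of C] C by (simp add: Compl_eq_Diff_UNIV)
  then have 2: "exp (- s * a) * (1 - B.prob C) \<le> prob (leader x0 a (- C))"
    using prob_leader_ge[OF C' a] by simp
  have "prob (complement_event x0 a C) = prob (leader x0 a (- C) \<union> (leader x0 0 UNIV \<inter> hit x0 a))"
    unfolding complement_event_def using ev by (intro prob_Int_tame) auto
  also have "\<dots> = prob (leader x0 a (- C)) + prob (leader x0 0 UNIV \<inter> hit x0 a)"
    using ev leader_not_hit by (intro finite_measure_Union) auto
  finally show ?thesis using 1 2 by (simp add: algebra_simps)
qed

end

section \<open>The law of height and angle\<close>

lemma (in cell_process) has_law_height_angle:
  "has_law P (\<lambda>\<phi>. (1 / cell_height \<phi> x0 ^ DIM('a), (sin (cell_angle \<phi> x0))\<^sup>2))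
     (exponential_law s \<Otimes>\<^sub>M beta_law (real DIM('a) / 2 + 1) (real DIM('a) / 2))"
proof (rule has_law_pair_of_inner_events[where \<G>="range greaterThan" and F="\<lambda>i. {- real i<..}"])
  show "prob_space P" by (rule prob_space_axioms)
  show "prob_space (exponential_law s)" by (rule prob_space_exponential_law[OF s_pos])
  show "prob_space (beta_law (real DIM('a) / 2 + 1) (real DIM('a) / 2))" by (rule B.prob_space_axioms)
  show "(borel :: real measure) = sigma UNIV (range greaterThan)" by (rule borel_Ioi)
  show "Int_stable (range (greaterThan :: real \<Rightarrow> real set))"
  proof -
    have "{a<..} \<inter> {b<..} = {max a b<..}" for a b :: real by auto
    then show ?thesis by (auto simp: Int_stable_def)
  qed
  show "(\<Union>i. {- real i<..}) = UNIV"
  proof -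
    have "\<exists>i. - real i < x" for x using reals_Archimedean2[of "- x"] by (auto simp: minus_less_iff)
    then show ?thesis by auto
  qed
  fix H :: "real set" and C :: "real set" assume "H \<in> range greaterThan" and C: "C \<in> sets borel"
  then obtain a where H: "H = {a<..}" by blast
  \<comment> \<open>Levels are positive, so a negative threshold acts like \<open>0\<close>.\<close>
  define a' where "a' = max 0 a"
  have a': "0 \<le> a'" by (simp add: a'_def)
  show "\<exists>A\<in>sets P. \<exists>B\<in>sets P. A \<subseteq> {\<phi>. 1 / cell_height \<phi> x0 ^ DIM('a) \<in> H \<and> (sin (cell_angle \<phi> x0))\<^sup>2 \<in> C} \<and>
      B \<subseteq> {\<phi>. \<not> (1 / cell_height \<phi> x0 ^ DIM('a) \<in> H \<and> (sin (cell_angle \<phi> x0))\<^sup>2 \<in> C)} \<and>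
      measure (exponential_law s) H * B.prob C \<le> measure P A \<and>
      1 - measure (exponential_law s) H * B.prob C \<le> measure P B"
  proof (rule bexI[of _ "inner_event x0 a' C"], rule bexI[of _ "complement_event x0 a' C"], intro conjI)
    show "inner_event x0 a' C \<in> sets P" "complement_event x0 a' C \<in> sets P"
      unfolding sets_P using C by (rule sets_events)+
    have "measure (exponential_law s) H = exp (- s * a')"
      unfolding H a'_def by (rule measure_exponential_law_greaterThan[OF s_pos])
    then show "measure (exponential_law s) H * B.prob C \<le> measure P (inner_event x0 a' C)"
      "1 - measure (exponential_law s) H * B.prob C \<le> measure P (complement_event x0 a' C)"
      using prob_inner_event_ge[OF C a'] prob_complement_event_ge[OF C a'] by simp_all
    show "inner_event x0 a' C \<subseteq> {\<phi>. 1 / cell_height \<phi> x0 ^ DIM('a) \<in> H \<and> (sin (cell_angle \<phi> x0))\<^sup>2 \<in> C}"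
      using height_and_angle_inner_event[OF _ a', of _ x0 C] by (fastforce simp: H a'_def)
    show "complement_event x0 a' C \<subseteq> {\<phi>. \<not> (1 / cell_height \<phi> x0 ^ DIM('a) \<in> H \<and> (sin (cell_angle \<phi> x0))\<^sup>2 \<in> C)}"
    proof
      fix \<phi> assume \<phi>: "\<phi> \<in> complement_event x0 a' C"
      note o = height_and_angle_complement_event[OF \<phi> a']
      have "0 < 1 / cell_height \<phi> x0 ^ DIM('a)" using o(1) by simp
      then show "\<phi> \<in> {\<phi>. \<not> (1 / cell_height \<phi> x0 ^ DIM('a) \<in> H \<and> (sin (cell_angle \<phi> x0))\<^sup>2 \<in> C)}"
        using o(2) by (auto simp: H a'_def max_def split: if_splits)
    qed
  qed
qed auto

text \<open>
  Bounds for the conditional laws pass to the mixture. Only positive \<open>s\<close> matter because \<open>R\<^sub>1\<close> is almost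
  surely positive.
\<close>

lemma mixture_lower_bound:
  assumes R1: "has_law M R1 (exponential_law 1)"
    and cond: "conditional_law M R1 borel \<Phi> N K"
    and A: "A \<in> sets N" and f: "f \<in> borel_measurable borel"
    and le: "\<And>s. s > 0 \<Longrightarrow> f s \<le> measure (K s) A"
  shows "(\<integral>\<^sup>+r. ennreal (f r) \<partial>exponential_law 1) \<le> emeasure M {\<omega>\<in>space M. \<Phi> \<omega> \<in> A}"
proof -
  have R: "R1 \<in> M \<rightarrow>\<^sub>M borel" and K: "K \<in> borel \<rightarrow>\<^sub>M prob_algebra N" using cond by (simp_all add: conditional_law_def)
  have "distr M borel R1 = distr (completion M) borel R1" using R by (rule distr_completion[symmetric])
  also have "\<dots> = distr (completion M) (exponential_law 1) R1" by (rule distr_cong) auto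
  also have "\<dots> = exponential_law 1" using R1 by (simp add: has_law_def)
  finally have law: "distr M borel R1 = exponential_law 1" .
  have "AE r in exponential_law 1. 0 < r"
  proof -
    have "AE r in lborel. r \<noteq> (0::real)" by (rule AE_lborel_singleton)
    then have "AE r in lborel. 0 < ennreal (exponential_density 1 r) \<longrightarrow> 0 < r"
      by eventually_elim (auto simp: exponential_density_def)
    then show ?thesis unfolding exponential_law_def by (subst AE_density) auto
  qed
  then have pos: "AE \<omega> in M. 0 < R1 \<omega>"
    unfolding law[symmetric] using R by (subst (asm) AE_distr_iff) auto
  have "(\<integral>\<^sup>+r. ennreal (f r) \<partial>exponential_law 1) = (\<integral>\<^sup>+\<omega>. ennreal (f (R1 \<omega>)) \<partial>M)"
    unfolding law[symmetric] using R f by (subst nn_integral_distr) auto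
  also have "\<dots> \<le> (\<integral>\<^sup>+\<omega>. emeasure (K (R1 \<omega>)) A \<partial>M)"
  proof (rule nn_integral_mono_AE)
    show "AE \<omega> in M. ennreal (f (R1 \<omega>)) \<le> emeasure (K (R1 \<omega>)) A"
      using pos
    proof eventually_elim
      case (elim \<omega>)
      interpret prob_space "K (R1 \<omega>)" using measurable_space[OF K] by (simp add: space_prob_algebra)
      show ?case using le[OF elim] by (simp add: emeasure_eq_measure ennreal_leI)
    qed
  qed
  also have "\<dots> = emeasure M {\<omega>\<in>space M. R1 \<omega> \<in> UNIV \<and> \<Phi> \<omega> \<in> A}"
  proof -
    have "\<forall>B\<in>sets borel. \<forall>C\<in>sets N. emeasure M {\<omega>\<in>space M. R1 \<omega> \<in> B \<and> \<Phi> \<omega> \<in> C} =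
        (\<integral>\<^sup>+\<omega>. indicator B (R1 \<omega>) * emeasure (K (R1 \<omega>)) C \<partial>M)"
      using cond unfolding conditional_law_def by blast
    from bspec[OF bspec[OF this, of UNIV] A] show ?thesis by simp
  qed
  finally show ?thesis by simp
qed

theorem proposition5p4:
  fixes d :: nat
    and M :: "'w measure"
    and R1 :: "'w \<Rightarrow> real"
    and \<Phi> :: "'w \<Rightarrow> ('a::euclidean_space \<times> real) set"
    and K :: "real \<Rightarrow> ('a \<times> real) set measure"
    and x0 :: 'a
  assumes d: "d \<ge> 2" "DIM('a) = d - 1"
    and M: "prob_space M"
    and R1: "has_law M R1 (exponential_law 1)"
    and cond: "conditional_law M R1 borel \<Phi> (config_space upper_half_space) K"
    and poisson: "\<And>s. s > 0 \<Longrightarrow> poisson_process_law upper_half_space (cell_intensity d s) (K s)"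
  shows "(\<forall>s>0. has_law (K s)
            (\<lambda>\<phi>. (1 / cell_height \<phi> x0 ^ (d - 1), (sin (cell_angle \<phi> x0))\<^sup>2))
            (exponential_law s \<Otimes>\<^sub>M beta_law ((real d + 1) / 2) ((real d - 1) / 2)))
       \<and> has_law M
            (\<lambda>\<omega>. (cell_height (\<Phi> \<omega>) x0 ^ (d - 1), (sin (cell_angle (\<Phi> \<omega>) x0))\<^sup>2))
            (distr uniform_law borel (\<lambda>u. (1 - u) / u)
              \<Otimes>\<^sub>M beta_law ((real d + 1) / 2) ((real d - 1) / 2))"
proof -
  interpret M: prob_space M by (rule M)
  define n where "n = DIM('a)"
  have dn: "d = Suc n" "d - 1 = n" using d by (auto simp: n_def)
  have beta: "beta_law ((real d + 1) / 2) ((real d - 1) / 2) = beta_law (real DIM('a) / 2 + 1) (real DIM('a) / 2)"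
    unfolding dn(1) by (simp add: n_def[symmetric] add_divide_distrib add.commute)
  let ?\<beta> = "beta_law (real DIM('a) / 2 + 1) (real DIM('a) / 2)"
  interpret B: prob_space ?\<beta> by (rule prob_space_beta_law) auto
  have cells: "cell_process (K s) s" if "s > 0" for s
    using that poisson[OF that] unfolding dn(1) n_def by unfold_locales
  have \<Phi>: "\<Phi> \<in> M \<rightarrow>\<^sub>M config_space upper_half_space" using cond by (simp add: conditional_law_def)
  have events: "{\<omega>\<in>space M. \<Phi> \<omega> \<in> A} \<in> sets M" if "A \<in> sets (config_space upper_half_space)" for A
    using \<Phi> that by measurable
  have ge_inner: "B.prob C / (1 + a) \<le> M.prob {\<omega>\<in>space M. \<Phi> \<omega> \<in> inner_event x0 a C}"
    if C: "C \<in> sets borel" and a: "0 \<le> a" for a C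
  proof -
    have "ennreal (B.prob C / (1 + a)) = (\<integral>\<^sup>+r. ennreal (exp (- r * a) * B.prob C) \<partial>exponential_law 1)"
      by (rule nn_integral_exponential_law[OF a measure_nonneg, symmetric])
    also have "\<dots> \<le> emeasure M {\<omega>\<in>space M. \<Phi> \<omega> \<in> inner_event x0 a C}"
      using cell_process.prob_inner_event_ge[OF cells C a] sets_events(6)[OF C]
      by (intro mixture_lower_bound[OF R1 cond]) auto
    finally show ?thesis by (simp add: M.emeasure_eq_measure)
  qed
  have ge_complement: "1 - B.prob C / (1 + a) \<le> M.prob {\<omega>\<in>space M. \<Phi> \<omega> \<in> complement_event x0 a C}"
    if C: "C \<in> sets borel" and a: "0 \<le> a" for a C
  proof -
    have "ennreal (1 - B.prob C / (1 + a)) = (\<integral>\<^sup>+r. ennreal (1 - exp (- r * a) * B.prob C) \<partial>exponential_law 1)"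
      by (rule nn_integral_exponential_law_compl[OF a measure_nonneg B.prob_le_1, symmetric])
    also have "\<dots> \<le> emeasure M {\<omega>\<in>space M. \<Phi> \<omega> \<in> complement_event x0 a C}"
      using cell_process.prob_complement_event_ge[OF cells C a] sets_events(7)[OF C]
      by (intro mixture_lower_bound[OF R1 cond]) auto
    finally show ?thesis by (simp add: M.emeasure_eq_measure)
  qed
  have "has_law (K s) (\<lambda>\<phi>. (1 / cell_height \<phi> x0 ^ n, (sin (cell_angle \<phi> x0))\<^sup>2)) (exponential_law s \<Otimes>\<^sub>M ?\<beta>)"
    if "s > 0" for s
    unfolding n_def by (rule cell_process.has_law_height_angle[OF cells[OF that]])
  moreover have "has_law M (\<lambda>\<omega>. (cell_height (\<Phi> \<omega>) x0 ^ n, (sin (cell_angle (\<Phi> \<omega>) x0))\<^sup>2))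
      (distr uniform_law borel (\<lambda>u. (1 - u) / u) \<Otimes>\<^sub>M ?\<beta>)"
  proof (rule has_law_pair_of_inner_events[where \<G>="range lessThan" and F="\<lambda>i. {..<real i}"])
    show "(borel :: real measure) = sigma UNIV (range lessThan)" by (rule borel_Iio)
    show "Int_stable (range (lessThan :: real \<Rightarrow> real set))"
    proof -
      have "{..<a} \<inter> {..<b} = {..<min a b}" for a b :: real by auto
      then show ?thesis by (auto simp: Int_stable_def)
    qed
    show "(\<Union>i. {..<real i}) = UNIV" using reals_Archimedean2 by auto
    fix H :: "real set" and C :: "real set" assume "H \<in> range lessThan" and C: "C \<in> sets borel"
    then obtain y where H: "H = {..<y}" by blast
    let ?odds = "distr uniform_law borel (\<lambda>u. (1 - u) / u) :: real measure"
    show "\<exists>A\<in>sets M. \<exists>B\<in>sets M. A \<subseteq> {\<omega>. cell_height (\<Phi> \<omega>) x0 ^ n \<in> H \<and> (sin (cell_angle (\<Phi> \<omega>) x0))\<^sup>2 \<in> C} \<and>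
      B \<subseteq> {\<omega>. \<not> (cell_height (\<Phi> \<omega>) x0 ^ n \<in> H \<and> (sin (cell_angle (\<Phi> \<omega>) x0))\<^sup>2 \<in> C)} \<and>
      measure ?odds H * B.prob C \<le> M.prob A \<and> 1 - measure ?odds H * B.prob C \<le> M.prob B"
    proof (cases "0 < y")
      case True
      then have a: "0 \<le> 1 / y" by simp
      have odds: "measure ?odds H * B.prob C = B.prob C / (1 + 1 / y)"
        using True unfolding H measure_odds_lessThan by (simp add: field_simps)
      \<comment> \<open>The event \<open>\<H> ^ n < y\<close> is the event that the level exceeds \<open>1 / y\<close>.\<close>
      have inv: "1 / y < 1 / h ^ n \<longleftrightarrow> h ^ n < y" if "h > 0" for h :: real
        using True that by (simp add: field_simps)
      show ?thesis
      proof (rule bexI[of _ "{\<omega>\<in>space M. \<Phi> \<omega> \<in> inner_event x0 (1 / y) C}"], rule bexI[of _ "{\<omega>\<in>space M. \<Phi> \<omega> \<in> complement_event x0 (1 / y) C}"], intro conjI)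
        show "{\<omega>\<in>space M. \<Phi> \<omega> \<in> inner_event x0 (1 / y) C} \<subseteq> {\<omega>. cell_height (\<Phi> \<omega>) x0 ^ n \<in> H \<and> (sin (cell_angle (\<Phi> \<omega>) x0))\<^sup>2 \<in> C}"
          using height_and_angle_inner_event[OF _ a, of _ x0 C] inv by (auto simp: H n_def)
        show "{\<omega>\<in>space M. \<Phi> \<omega> \<in> complement_event x0 (1 / y) C} \<subseteq> {\<omega>. \<not> (cell_height (\<Phi> \<omega>) x0 ^ n \<in> H \<and> (sin (cell_angle (\<Phi> \<omega>) x0))\<^sup>2 \<in> C)}"
          using height_and_angle_complement_event[OF _ a, of _ x0 C] inv by (auto simp: H n_def)
      qed (use odds ge_inner[OF C a] ge_complement[OF C a] in \<open>auto intro!: events sets_events C\<close>)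
    next
      case False
      have odds: "measure ?odds H = 0" using False unfolding H measure_odds_lessThan by simp
      show ?thesis
      \<comment> \<open>For \<open>y \<le> 0\<close> the rectangle is a null set; \<open>complement_event x0 0 {}\<close> has probability \<open>1\<close> and implies \<open>\<H> > 0\<close>.\<close>
      proof (rule bexI[of _ "{}"], rule bexI[of _ "{\<omega>\<in>space M. \<Phi> \<omega> \<in> complement_event x0 0 {}}"], intro conjI)
        show "{\<omega>\<in>space M. \<Phi> \<omega> \<in> complement_event x0 0 {}} \<subseteq> {\<omega>. \<not> (cell_height (\<Phi> \<omega>) x0 ^ n \<in> H \<and> (sin (cell_angle (\<Phi> \<omega>) x0))\<^sup>2 \<in> C)}"
        proof
          fix \<omega> assume "\<omega> \<in> {\<omega>\<in>space M. \<Phi> \<omega> \<in> complement_event x0 0 {}}"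
          then have "0 < cell_height (\<Phi> \<omega>) x0" by (intro height_and_angle_complement_event[of _ x0 0 "{}"]) auto
          then have "y \<le> cell_height (\<Phi> \<omega>) x0 ^ n" using False zero_less_power[of _ n] by (smt (verit))
          then show "\<omega> \<in> {\<omega>. \<not> (cell_height (\<Phi> \<omega>) x0 ^ n \<in> H \<and> (sin (cell_angle (\<Phi> \<omega>) x0))\<^sup>2 \<in> C)}"
            by (auto simp: H)
        qed
      qed (use odds ge_complement[of "{}" 0] in \<open>auto intro!: events sets_events\<close>)
    qed
  qed (auto intro: prob_space_odds M B.prob_space_axioms)
  ultimately show ?thesis unfolding beta dn(2) by blast
qed

end
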